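(* Let $0<s<1<p<\infty$ be such that $sp^2<n$. Let $h\in L^\infty(\mathbb{R}^n)$, $h\ge0$, be such that the embedding $\mathcal{D}^{s,p}(\mathbb{R}^n)\subset L^p(h\,dx;\mathbb{R}^n)$ is compact, and suppose there exists $x_0\in\mathbb{R}^n$ such that $h$ is continuous at $x_0$ and $h(x_0)>0$. Define $$\lambda_1(h):= \inf_{v\in \mathcal{D}^{s,p}(\mathbb{R}^n)} \frac{[v]_{s,p}^p}{\int_{\mathbb{R}^n} h(x) |v|^p\, dx}.$$ Then for every $0<\lambda<\lambda_1(h)$ the equation $$(-\Delta_p)^s u = \lambda h(x)|u|^{p-2}u + |u|^{p^*_s-2}u\qquad\text{in }\mathbb{R}^n$$ has a nontrivial weak solution $u\in\mathcal{D}^{s,p}(\mathbb{R}^n)$.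
   Context: $[v]_{s,p}^p := \iint_{\mathbb{R}^n\times\mathbb{R}^n} \frac{|v(x)-v(y)|^p}{|x-y|^{n+sp}}\, dx\,dy$ and $p^*_s=\frac{np}{n-sp}$. $\mathcal{D}^{s,p}(\mathbb{R}^n)$ is the closure of $C_c^\infty(\mathbb{R}^n)$ with respect to $[\cdot]_{s,p}$; equivalently $\{v\in L^{p^*_s}(\mathbb{R}^n): [v]_{s,p}<\infty\}$, normed by $[\cdot]_{s,p}$. Compactness of the embedding into $L^p(h\,dx;\mathbb{R}^n)$ (the $L^p$ space for the measure $h\,dx$) means that it is continuous and every bounded sequence in $\mathcal{D}^{s,p}(\mathbb{R}^n)$ has a subsequence converging strongly in $L^p(h\,dx;\mathbb{R}^n)$. The infimum defining $\lambda_1(h)$ is over $v$ with $\int_{\mathbb{R}^n} h|v|^p\,dx>0$. A weak solution of the equation is a critical point $u\in\mathcal{D}^{s,p}(\mathbb{R}^n)$ of $\mathcal{F}_\lambda(u)=\frac1p[u]_{s,p}^p-\frac{\lambda}{p}\int_{\mathbb{R}^n} h|u|^p\,dx-\frac1{p^*_s}\int_{\mathbb{R}^n} |u|^{p^*_s}\,dx$, i.e. for all $v\in C_c^\infty(\mathbb{R}^n)$, $\iint_{\mathbb{R}^n\times\mathbb{R}^n}\frac{|u(x)-u(y)|^{p-2}(u(x)-u(y))(v(x)-v(y))}{|x-y|^{n+sp}}\,dx\,dy=\lambda\int_{\mathbb{R}^n} h|u|^{p-2}uv\,dx+\int_{\mathbb{R}^n} |u|^{p^*_s-2}uv\,dx$.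 *)

theory Defs
  imports "HOL-Analysis.Analysis"
begin

text \<open>
  Elements of function spaces are represented by Lebesgue measurable functions rather than by
  classes modulo null sets; the functionals below do not depend on the representative.
\<close>

definition Lp_space :: "'a measure \<Rightarrow> real \<Rightarrow> ('a \<Rightarrow> real) set" where
  "Lp_space M p = {f \<in> borel_measurable M. integrable M (\<lambda>x. \<bar>f x\<bar> powr p)}"

definition Lp_norm :: "'a measure \<Rightarrow> real \<Rightarrow> ('a \<Rightarrow> real) \<Rightarrow> real" where
  "Lp_norm M p f = (LINT x|M. \<bar>f x\<bar> powr p) powr (1 / p)"

definition Linfty_space :: "'a measure \<Rightarrow> ('a \<Rightarrow> real) set" where
  "Linfty_space M = {f \<in> borel_measurable M. \<exists>C. AE x in M. \<bar>f x\<bar> \<le> C}"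

abbreviation weighted_measure :: "(real ^ 'n \<Rightarrow> real) \<Rightarrow> (real ^ 'n) measure" where
  "weighted_measure h \<equiv> density lebesgue (\<lambda>x. ennreal (h x))"

text \<open>\<open>Ck k f\<close>: all partial derivatives of \<open>f\<close> up to order \<open>k\<close> exist and are continuous.\<close>

primrec Ck :: "nat \<Rightarrow> (real ^ 'n \<Rightarrow> real) \<Rightarrow> bool" where
  "Ck 0 f \<longleftrightarrow> continuous_on UNIV f"
| "Ck (Suc k) f \<longleftrightarrow> (\<forall>x. f differentiable (at x)) \<and>
     (\<forall>i. Ck k (\<lambda>x. frechet_derivative f (at x) (axis i 1)))"

definition test_functions :: "(real ^ 'n \<Rightarrow> real) set" where
  "test_functions = {v. (\<forall>k. Ck k v) \<and> compact (closure {x. v x \<noteq> 0})}"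

definition critical_exponent :: "nat \<Rightarrow> real \<Rightarrow> real \<Rightarrow> real" where
  "critical_exponent n s p = real n * p / (real n - s * p)"

text \<open>
  On the diagonal the integrand is \<open>0 / 0 = 0\<close>, which is harmless as the diagonal is a null set.
  The double integral is an integral for Lebesgue measure on the product space.
\<close>

definition gagliardo_integrand ::
    "real \<Rightarrow> real \<Rightarrow> (real ^ 'n \<Rightarrow> real) \<Rightarrow> (real ^ 'n) \<times> (real ^ 'n) \<Rightarrow> real" where
  "gagliardo_integrand s p v =
     (\<lambda>(x, y). \<bar>v x - v y\<bar> powr p / norm (x - y) powr (real CARD('n) + s * p))"

text \<open>The \<open>p\<close>-th power of the Gagliardo seminorm:\<close>

definition gagliardo_energy :: "real \<Rightarrow> real \<Rightarrow> (real ^ 'n \<Rightarrow> real) \<Rightarrow> real" where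
  "gagliardo_energy s p v = (LINT z|lebesgue. gagliardo_integrand s p v z)"

definition gagliardo_seminorm :: "real \<Rightarrow> real \<Rightarrow> (real ^ 'n \<Rightarrow> real) \<Rightarrow> real" where
  "gagliardo_seminorm s p v = gagliardo_energy s p v powr (1 / p)"

definition Dsp :: "real \<Rightarrow> real \<Rightarrow> (real ^ 'n \<Rightarrow> real) set" where
  "Dsp s p = {v \<in> Lp_space lebesgue (critical_exponent CARD('n) s p).
     integrable lebesgue (gagliardo_integrand s p v)}"

text \<open>
  \<open>X\<close> and \<open>Y\<close> are spaces of functions with (semi)norms \<open>NX\<close> and \<open>NY\<close>; the embedding is the
  inclusion map.
\<close>

definition compactly_embedded ::
    "('a \<Rightarrow> real) set \<Rightarrow> (('a \<Rightarrow> real) \<Rightarrow> real) \<Rightarrow>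
     ('a \<Rightarrow> real) set \<Rightarrow> (('a \<Rightarrow> real) \<Rightarrow> real) \<Rightarrow> bool" where
  "compactly_embedded X NX Y NY \<longleftrightarrow>
     X \<subseteq> Y \<and>
     (\<forall>u\<in>X. \<forall>\<epsilon>>0. \<exists>\<delta>>0. \<forall>v\<in>X. NX (\<lambda>x. v x - u x) < \<delta> \<longrightarrow> NY (\<lambda>x. v x - u x) < \<epsilon>) \<and>
     (\<forall>f :: nat \<Rightarrow> 'a \<Rightarrow> real.
        (\<forall>k. f k \<in> X) \<and> bounded (range (\<lambda>k. NX (f k))) \<longrightarrow>
        (\<exists>r w. strict_mono r \<and> w \<in> Y \<and> (\<lambda>k. NY (\<lambda>x. f (r k) x - w x)) \<longlonglongrightarrow> 0))"

text \<open>
  If some \<open>v \<in> Dsp s p\<close> satisfies the positivity condition, this is the infimum of a nonempty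
  set of nonnegative reals.
\<close>

definition first_eigenvalue :: "real \<Rightarrow> real \<Rightarrow> (real ^ 'n \<Rightarrow> real) \<Rightarrow> real" where
  "first_eigenvalue s p h =
     Inf {gagliardo_energy s p v / (LINT x|lebesgue. h x * \<bar>v x\<bar> powr p) | v.
            v \<in> Dsp s p \<and> (LINT x|lebesgue. h x * \<bar>v x\<bar> powr p) > 0}"

text \<open>
  Expressions \<open>\<bar>t\<bar> powr q * t\<close> vanish at \<open>t = 0\<close>, also for negative \<open>q\<close>. For bounded \<open>h\<close>,
  \<open>u \<in> Dsp s p\<close> and a test function \<open>v\<close>, all three integrands are integrable.
\<close>

definition weak_solution :: "real \<Rightarrow> real \<Rightarrow> real \<Rightarrow> (real ^ 'n \<Rightarrow> real) \<Rightarrow> (real ^ 'n \<Rightarrow> real) \<Rightarrow> bool"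
  where
  "weak_solution s p lam h u \<longleftrightarrow>
     u \<in> Dsp s p \<and>
     (\<forall>v\<in>test_functions.
        (LINT (x, y)|lebesgue.
           \<bar>u x - u y\<bar> powr (p - 2) * (u x - u y) * (v x - v y)
             / norm (x - y) powr (real CARD('n) + s * p))
        = lam * (LINT x|lebesgue. h x * \<bar>u x\<bar> powr (p - 2) * u x * v x)
          + (LINT x|lebesgue.
               \<bar>u x\<bar> powr (critical_exponent CARD('n) s p - 2) * u x * v x))"

end

theory Submission
  imports Defs "HOL-Library.Diagonal_Subsequence"
begin

text \<open>
  Minimise \<open>Q u = [u]^p - \<lambda> \<integral> h |u|^p\<close> under \<open>\<integral> |u|^q = 1\<close>, where \<open>q\<close> is the critical exponent; as
  \<open>\<lambda> < \<lambda>\<^sub>1(h)\<close>, the infimum \<open>S1\<close> is positive, and a multiple of a minimiser solves the equation.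

  Comparing \<open>u x\<close> with its mean over balls gives the Sobolev inequality in the sharper form
  \<open>\<integral> |u|^q \<le> C M^(q - p) [u]^p\<close>, where \<open>M\<close> bounds the scaled means of \<open>|u|\<close> over all balls. Hence a
  normalised function with bounded energy can be translated and dilated so as to have mass in a
  fixed ball on which \<open>h\<close> is bounded below. Applied to near-minimisers of the Sobolev constant \<open>S0\<close>,
  this gives \<open>S1 < S0\<close>.

  By scaling, the compact embedding yields almost everywhere convergent subsequences of bounded
  sequences. For a minimising sequence with limit \<open>g\<close> and \<open>a = \<integral> |g|^q\<close>, the Brezis--Lieb lemma gives
  \<open>S1 \<ge> S1 a^(p/q) + S0 (1 - a)^(p/q)\<close>, which forces \<open>a = 1\<close>: no mass is lost and \<open>g\<close> is a minimiser.
\<close>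

section \<open>The Brezis--Lieb lemma and differentiation of power integrals\<close>

text \<open>Mass and energy are both unchanged by translations and by the dilations taking
  \<open>u y\<close> to \<open>c powr (n / q) * u (c y)\<close>. A bounded sequence can therefore
  concentrate or drift away without converging, and this is the obstacle to compactness. The means
  over balls of radius \<open>r\<close> are compared with \<open>r powr (- n / q)\<close> because
  that bound has the same invariance: a ball violating it can be moved onto any prescribed ball at
  no cost.

  The potential is not invariant, and by the compact embedding it passes to the limit along
  subsequences. Mass lost in the limit thus takes no potential with it, so its price is
  \<open>S0\<close> and not \<open>S1\<close>. With \<open>S1 < S0\<close> and the exponent
  \<open>p / q < 1\<close>, losing mass is strictly more expensive than keeping it.

  All infima are taken over Borel functions. This keeps Fubini and affine substitutions within
  \<open>lborel\<close>; the smaller class suffices because it contains the test functions, is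
  closed under the limits taken, and lies in \<open>Dsp s p\<close>.\<close>

text \<open>Mean value theorem; a left endpoint at 0 is treated separately because the derivative of
  \<open>powr\<close> is taken at positive bases.\<close>

lemma powr_diff_bound:
  fixes x y q :: real
  assumes "0 \<le> x" "0 \<le> y" "1 \<le> q"
  shows "\<bar>x powr q - y powr q\<bar> \<le> q * max x y powr (q - 1) * \<bar>x - y\<bar>"
proof -
  have *: "b powr q - a powr q \<le> q * b powr (q - 1) * (b - a)" if "0 \<le> a" "a < b" for a b :: real
  proof (cases "a = 0")
    case True
    have "b powr q = b powr (q - 1) * b"
      using that powr_mult_base[of b "q - 1"] by (simp add: mult.commute)
    also have "\<dots> \<le> q * (b powr (q - 1) * b)"
      using assms that by (intro mult_right_mono[of 1 q, simplified]) auto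
    finally show ?thesis using True by (simp add: mult.assoc)
  next
    case False
    have "\<exists>z. a < z \<and> z < b \<and> b powr q - a powr q = (b - a) * (q * z powr (q - 1))"
      using that False by (intro MVT2) (auto intro!: derivative_eq_intros)
    then obtain z where z: "a < z" "z < b" "b powr q - a powr q = (b - a) * (q * z powr (q - 1))"
      by blast
    have "z powr (q - 1) \<le> b powr (q - 1)" using z assms that by (intro powr_mono2) auto
    then have "(b - a) * (q * z powr (q - 1)) \<le> (b - a) * (q * b powr (q - 1))"
      using that assms by (intro mult_left_mono) auto
    then show ?thesis using z by (simp add: mult_ac)
  qed
  have mono: "a powr q \<le> b powr q" if "0 \<le> a" "a \<le> b" for a b :: real
    using that assms by (intro powr_mono2) auto
  consider "x = y" | "x < y" | "y < x" by linarith
  then show ?thesis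
  proof cases
    case 1 then show ?thesis by simp
  next
    case 2 then show ?thesis using *[of x y] mono[of x y] assms by (simp add: max_def)
  next
    case 3 then show ?thesis using *[of y x] mono[of y x] assms by (simp add: max_def)
  qed
qed

lemma abs_powr_diff_bound:
  fixes a b q :: real
  assumes "1 \<le> q"
  shows "\<bar>\<bar>a + b\<bar> powr q - \<bar>a\<bar> powr q\<bar> \<le> q * (\<bar>a\<bar> + \<bar>b\<bar>) powr (q - 1) * \<bar>b\<bar>"
proof -
  have "\<bar>\<bar>a + b\<bar> powr q - \<bar>a\<bar> powr q\<bar> \<le> q * max \<bar>a + b\<bar> \<bar>a\<bar> powr (q - 1) * \<bar>\<bar>a + b\<bar> - \<bar>a\<bar>\<bar>"
    using assms by (intro powr_diff_bound) auto
  also have "\<dots> \<le> q * (\<bar>a\<bar> + \<bar>b\<bar>) powr (q - 1) * \<bar>b\<bar>"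
    using assms by (intro mult_mono powr_mono2) auto
  finally show ?thesis .
qed

lemma abs_add_powr_le:
  fixes a b q :: real
  assumes "0 \<le> q"
  shows "\<bar>a + b\<bar> powr q \<le> 2 powr q * (\<bar>a\<bar> powr q + \<bar>b\<bar> powr q)"
proof -
  have "\<bar>a + b\<bar> powr q \<le> (2 * max \<bar>a\<bar> \<bar>b\<bar>) powr q"
    using assms by (intro powr_mono2) auto
  also have "\<dots> = 2 powr q * max \<bar>a\<bar> \<bar>b\<bar> powr q" by (simp add: powr_mult)
  also have "\<dots> \<le> 2 powr q * (\<bar>a\<bar> powr q + \<bar>b\<bar> powr q)"
    by (intro mult_left_mono) (auto simp: max_def)
  finally show ?thesis .
qed

text \<open>The pointwise inequality behind Brezis--Lieb. If \<open>b\<close> is small relative to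
  \<open>a\<close>, the linear bound is absorbed by \<open>e * \<bar>a\<bar> powr q\<close>;
  otherwise \<open>a\<close> is itself controlled by a multiple of \<open>b\<close>. The threshold
  \<open>d\<close> is what the first case requires.\<close>

lemma abs_powr_diff_eps:
  fixes q e :: real
  assumes q: "1 \<le> q" and e: "0 < e"
  obtains C where "0 \<le> C"
    "\<And>a b :: real. \<bar>\<bar>a + b\<bar> powr q - \<bar>a\<bar> powr q\<bar> \<le> e * \<bar>a\<bar> powr q + C * \<bar>b\<bar> powr q"
proof -
  define d where "d = min 1 (e / (q * 2 powr (q - 1)))"
  have d: "0 < d" "d \<le> 1" "q * 2 powr (q - 1) * d \<le> e"
    using q e by (auto simp: d_def field_simps min_def)
  define C where "C = q * (1 / d + 1) powr (q - 1)"
  have "0 \<le> C" using q by (auto simp: C_def)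
  have pb: "t powr (q - 1) * t = t powr q" if "0 \<le> t" for t :: real
    using that powr_mult_base[of t "q - 1"] by (simp add: mult.commute)
  have "\<bar>\<bar>a + b\<bar> powr q - \<bar>a\<bar> powr q\<bar> \<le> e * \<bar>a\<bar> powr q + C * \<bar>b\<bar> powr q" for a b :: real
  proof (cases "\<bar>b\<bar> \<le> d * \<bar>a\<bar>")
    case True
    have "\<bar>b\<bar> \<le> \<bar>a\<bar>" using True d mult_left_le_one_le[of "\<bar>a\<bar>" d] by linarith
    have "q * (\<bar>a\<bar> + \<bar>b\<bar>) powr (q - 1) * \<bar>b\<bar> \<le> q * (2 * \<bar>a\<bar>) powr (q - 1) * (d * \<bar>a\<bar>)"
      using q True \<open>\<bar>b\<bar> \<le> \<bar>a\<bar>\<close> by (intro mult_mono powr_mono2) auto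
    also have "\<dots> = (q * 2 powr (q - 1) * d) * \<bar>a\<bar> powr q"
      using pb[of "\<bar>a\<bar>"] by (simp add: powr_mult mult_ac)
    also have "\<dots> \<le> e * \<bar>a\<bar> powr q" using d by (intro mult_right_mono) auto
    finally have "q * (\<bar>a\<bar> + \<bar>b\<bar>) powr (q - 1) * \<bar>b\<bar> \<le> e * \<bar>a\<bar> powr q" .
    moreover have "0 \<le> C * \<bar>b\<bar> powr q" using \<open>0 \<le> C\<close> by simp
    ultimately show ?thesis using abs_powr_diff_bound[OF q, of a b] by linarith
  next
    case False
    then have "\<bar>a\<bar> + \<bar>b\<bar> \<le> (1 / d + 1) * \<bar>b\<bar>" using d by (simp add: field_simps)
    then have "q * (\<bar>a\<bar> + \<bar>b\<bar>) powr (q - 1) * \<bar>b\<bar> \<le> q * ((1 / d + 1) * \<bar>b\<bar>) powr (q - 1) * \<bar>b\<bar>"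
      using q d by (intro mult_mono powr_mono2) auto
    also have "\<dots> = C * \<bar>b\<bar> powr q"
      using pb[of "\<bar>b\<bar>"] d by (simp add: powr_mult mult_ac C_def)
    finally have "q * (\<bar>a\<bar> + \<bar>b\<bar>) powr (q - 1) * \<bar>b\<bar> \<le> C * \<bar>b\<bar> powr q" .
    moreover have "0 \<le> e * \<bar>a\<bar> powr q" using e by simp
    ultimately show ?thesis using abs_powr_diff_bound[OF q, of a b] by linarith
  qed
  then show ?thesis using \<open>0 \<le> C\<close> that by blast
qed

lemma integrable_powr_add:
  fixes f g :: "'a \<Rightarrow> real"
  assumes [measurable]: "f \<in> borel_measurable M" "g \<in> borel_measurable M"
    and "integrable M (\<lambda>x. \<bar>f x\<bar> powr q)" "integrable M (\<lambda>x. \<bar>g x\<bar> powr q)" "0 \<le> q"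
  shows "integrable M (\<lambda>x. \<bar>f x + g x\<bar> powr q)"
proof (rule Bochner_Integration.integrable_bound)
  show "integrable M (\<lambda>x. 2 powr q * (\<bar>f x\<bar> powr q + \<bar>g x\<bar> powr q))"
    using assms by auto
  show "AE x in M. norm (\<bar>f x + g x\<bar> powr q) \<le> norm (2 powr q * (\<bar>f x\<bar> powr q + \<bar>g x\<bar> powr q))"
    using abs_add_powr_le[OF \<open>0 \<le> q\<close>] by auto
qed measurable

lemma integrable_powr_scale:
  fixes f :: "'a \<Rightarrow> real"
  assumes "integrable M (\<lambda>x. \<bar>f x\<bar> powr q)"
  shows "integrable M (\<lambda>x. \<bar>c * f x\<bar> powr q)"
  using assms by (simp add: abs_mult powr_mult)

lemma integrable_powr_diff:
  fixes f g :: "'a \<Rightarrow> real"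
  assumes [measurable]: "f \<in> borel_measurable M" "g \<in> borel_measurable M"
    and "integrable M (\<lambda>x. \<bar>f x\<bar> powr q)" "integrable M (\<lambda>x. \<bar>g x\<bar> powr q)" "0 \<le> q"
  shows "integrable M (\<lambda>x. \<bar>f x - g x\<bar> powr q)"
  using integrable_powr_add[of f M "\<lambda>x. - g x" q] assms by simp

lemma powr_tendsto_abs:
  fixes X :: "nat \<Rightarrow> real"
  assumes "X \<longlonglongrightarrow> l" "0 < q"
  shows "(\<lambda>k. \<bar>X k\<bar> powr q) \<longlonglongrightarrow> \<bar>l\<bar> powr q"
  using assms by (intro tendsto_powr2 tendsto_rabs) auto

text \<open>Puts almost everywhere limits of bounded sequences back into the space, both for
  functions and for their difference quotients.\<close>

lemma fatou_powr:
  fixes f :: "nat \<Rightarrow> 'a \<Rightarrow> real"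
  assumes [measurable]: "\<And>k. f k \<in> borel_measurable M" "g \<in> borel_measurable M"
    and lim: "AE x in M. (\<lambda>k. f k x) \<longlonglongrightarrow> g x" and q: "0 < q"
    and int: "\<And>k. integrable M (\<lambda>x. \<bar>f k x\<bar> powr q)"
    and bd: "\<And>k. (LINT x|M. \<bar>f k x\<bar> powr q) \<le> C"
  shows "integrable M (\<lambda>x. \<bar>g x\<bar> powr q)"
proof (rule integrableI_bounded)
  have "(\<integral>\<^sup>+ x. ennreal (norm (\<bar>g x\<bar> powr q)) \<partial>M)
      \<le> (\<integral>\<^sup>+ x. liminf (\<lambda>k. ennreal (\<bar>f k x\<bar> powr q)) \<partial>M)"
  proof (rule nn_integral_mono_AE)
    show "AE x in M. ennreal (norm (\<bar>g x\<bar> powr q)) \<le> liminf (\<lambda>k. ennreal (\<bar>f k x\<bar> powr q))"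
      using lim
    proof eventually_elim
      case (elim x)
      have "(\<lambda>k. ennreal (\<bar>f k x\<bar> powr q)) \<longlonglongrightarrow> ennreal (\<bar>g x\<bar> powr q)"
        using powr_tendsto_abs[OF elim q] by (rule tendsto_ennrealI)
      then have "liminf (\<lambda>k. ennreal (\<bar>f k x\<bar> powr q)) = ennreal (\<bar>g x\<bar> powr q)"
        by (intro lim_imp_Liminf) auto
      then show ?case by simp
    qed
  qed
  also have "\<dots> \<le> liminf (\<lambda>k. \<integral>\<^sup>+ x. ennreal (\<bar>f k x\<bar> powr q) \<partial>M)"
    by (rule nn_integral_liminf) measurable
  also have "\<dots> \<le> liminf (\<lambda>k. ennreal C)"
    using bd by (intro Liminf_mono always_eventually allI)
      (simp add: nn_integral_eq_integral[OF int] ennreal_leI)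
  also have "\<dots> < \<infinity>" by (simp add: Liminf_const)
  finally show "(\<integral>\<^sup>+ x. ennreal (norm (\<bar>g x\<bar> powr q)) \<partial>M) < \<infinity>" .
qed measurable

text \<open>The powers of \<open>f k\<close> have no common integrable majorant. However, the part
  of the defect exceeding \<open>e * \<bar>f k x - g x\<bar> powr q\<close> is dominated by a
  multiple of \<open>\<bar>g x\<bar> powr q\<close>, so dominated convergence applies to it, and
  what remains has integral at most \<open>e\<close> times a uniform bound.\<close>

lemma brezis_lieb:
  fixes f :: "nat \<Rightarrow> 'a \<Rightarrow> real"
  assumes [measurable]: "\<And>k. f k \<in> borel_measurable M" "g \<in> borel_measurable M"
    and lim: "AE x in M. (\<lambda>k. f k x) \<longlonglongrightarrow> g x" and q: "1 \<le> q"
    and int: "\<And>k. integrable M (\<lambda>x. \<bar>f k x\<bar> powr q)"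
    and bd: "\<And>k. (LINT x|M. \<bar>f k x\<bar> powr q) \<le> C"
  shows "(\<lambda>k. (LINT x|M. \<bar>f k x\<bar> powr q) - (LINT x|M. \<bar>f k x - g x\<bar> powr q))
    \<longlonglongrightarrow> (LINT x|M. \<bar>g x\<bar> powr q)"
proof -
  have q0: "0 < q" using q by simp
  have ig: "integrable M (\<lambda>x. \<bar>g x\<bar> powr q)"
    using fatou_powr[OF assms(1,2) lim q0 int bd] .
  have id: "integrable M (\<lambda>x. \<bar>f k x - g x\<bar> powr q)" for k
    using q by (intro integrable_powr_diff int ig) auto
  define C1 where "C1 = 2 powr q * (C + (LINT x|M. \<bar>g x\<bar> powr q))"
  have bd1: "(LINT x|M. \<bar>f k x - g x\<bar> powr q) \<le> C1" for k
  proof -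
    have "(LINT x|M. \<bar>f k x - g x\<bar> powr q) \<le> (LINT x|M. 2 powr q * (\<bar>f k x\<bar> powr q + \<bar>g x\<bar> powr q))"
      using id int ig abs_add_powr_le[of q "f k _" "- g _"] q
      by (intro integral_mono) auto
    also have "\<dots> = 2 powr q * ((LINT x|M. \<bar>f k x\<bar> powr q) + (LINT x|M. \<bar>g x\<bar> powr q))"
      using int ig by simp
    also have "\<dots> \<le> C1" unfolding C1_def using bd by (intro mult_left_mono) auto
    finally show ?thesis .
  qed
  have "0 \<le> C1"
    by (rule order_trans[OF _ bd1[of 0]], rule integral_nonneg_AE) simp
  show ?thesis
  proof (rule LIMSEQ_I)
    fix r :: real assume r: "0 < r"
    \<comment> \<open>Makes \<open>e * C1 \<le> r / 2\<close>; the added 1 covers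
      \<open>C1 = 0\<close>.\<close>
    define e where "e = r / (2 * (C1 + 1))"
    have e: "0 < e" using r \<open>0 \<le> C1\<close> by (auto simp: e_def)
    obtain Ce where Ce: "0 \<le> Ce"
      "\<And>a b :: real. \<bar>\<bar>a + b\<bar> powr q - \<bar>a\<bar> powr q\<bar> \<le> e * \<bar>a\<bar> powr q + Ce * \<bar>b\<bar> powr q"
      using abs_powr_diff_eps[OF q e] by blast
    define D where "D k x = \<bar>\<bar>f k x\<bar> powr q - \<bar>f k x - g x\<bar> powr q - \<bar>g x\<bar> powr q\<bar>" for k x
    define W where "W k x = max 0 (D k x - e * \<bar>f k x - g x\<bar> powr q)" for k x
    have [measurable]: "D k \<in> borel_measurable M" "W k \<in> borel_measurable M" for k
      unfolding D_def W_def by measurable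
    have iD: "integrable M (D k)" for k
      unfolding D_def by (intro integrable_abs Bochner_Integration.integrable_diff int id ig)
    have iW: "integrable M (W k)" for k
      unfolding W_def by (intro integrable_max Bochner_Integration.integrable_diff iD
          integrable_mult_right id) auto
    have W_le: "\<bar>W k x\<bar> \<le> (1 + Ce) * \<bar>g x\<bar> powr q" for k x
    proof -
      have "D k x \<le> \<bar>\<bar>f k x\<bar> powr q - \<bar>f k x - g x\<bar> powr q\<bar> + \<bar>g x\<bar> powr q"
        unfolding D_def using abs_triangle_ineq4[of "\<bar>f k x\<bar> powr q - \<bar>f k x - g x\<bar> powr q" "\<bar>g x\<bar> powr q"] by simp
      also have "\<dots> \<le> e * \<bar>f k x - g x\<bar> powr q + Ce * \<bar>g x\<bar> powr q + \<bar>g x\<bar> powr q"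
        using Ce(2)[of "f k x - g x" "g x"] by simp
      finally show ?thesis using Ce(1) by (auto simp: W_def algebra_simps)
    qed
    have W0: "(\<lambda>k. LINT x|M. W k x) \<longlonglongrightarrow> (LINT x|M. 0)"
    proof (rule integral_dominated_convergence[where w = "\<lambda>x. (1 + Ce) * \<bar>g x\<bar> powr q"])
      show "AE x in M. (\<lambda>k. W k x) \<longlonglongrightarrow> 0"
        using lim
      proof eventually_elim
        case (elim x)
        have d0: "(\<lambda>k. f k x - g x) \<longlonglongrightarrow> 0" using elim by (simp add: LIM_zero)
        have a: "(\<lambda>k. \<bar>f k x - g x\<bar> powr q) \<longlonglongrightarrow> 0"
          using powr_tendsto_abs[OF d0 q0] q0 by simp
        have "(\<lambda>k. D k x) \<longlonglongrightarrow> \<bar>\<bar>g x\<bar> powr q - 0 - \<bar>g x\<bar> powr q\<bar>"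
          unfolding D_def by (intro tendsto_intros powr_tendsto_abs elim a q0)
        then have "(\<lambda>k. max 0 (D k x - e * \<bar>f k x - g x\<bar> powr q)) \<longlonglongrightarrow> max 0 (0 - e * 0)"
          by (intro tendsto_max tendsto_intros a) auto
        then show ?case by (simp add: W_def)
      qed
    qed (use ig W_le in auto)
    then have "\<forall>\<^sub>F k in sequentially. (LINT x|M. W k x) < r / 2"
      using r by (intro order_tendstoD) auto
    then obtain N where N: "\<And>k. N \<le> k \<Longrightarrow> (LINT x|M. W k x) < r / 2"
      by (auto simp: eventually_sequentially)
    have "norm ((LINT x|M. \<bar>f k x\<bar> powr q) - (LINT x|M. \<bar>f k x - g x\<bar> powr q)
        - (LINT x|M. \<bar>g x\<bar> powr q)) < r" if "N \<le> k" for k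
    proof -
      have "(LINT x|M. \<bar>f k x\<bar> powr q) - (LINT x|M. \<bar>f k x - g x\<bar> powr q) - (LINT x|M. \<bar>g x\<bar> powr q)
          = (LINT x|M. \<bar>f k x\<bar> powr q - \<bar>f k x - g x\<bar> powr q - \<bar>g x\<bar> powr q)"
        using int id ig by simp
      also have "norm \<dots> \<le> (LINT x|M. D k x)"
        unfolding D_def real_norm_def by (rule integral_abs_bound)
      also have "\<dots> \<le> (LINT x|M. W k x + e * \<bar>f k x - g x\<bar> powr q)"
        using iD iW id by (intro integral_mono) (auto simp: W_def)
      also have "\<dots> = (LINT x|M. W k x) + e * (LINT x|M. \<bar>f k x - g x\<bar> powr q)"
        using iW id by simp
      also have "\<dots> < r / 2 + e * (LINT x|M. \<bar>f k x - g x\<bar> powr q)" using N[OF that] by simp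
      also have "\<dots> \<le> r / 2 + e * C1" using bd1 e by (intro add_left_mono mult_left_mono) auto
      also have "\<dots> \<le> r" using r \<open>0 \<le> C1\<close> by (simp add: e_def field_simps)
      finally show ?thesis .
    qed
    then show "\<exists>no. \<forall>k\<ge>no. norm ((LINT x|M. \<bar>f k x\<bar> powr q) - (LINT x|M. \<bar>f k x - g x\<bar> powr q)
        - (LINT x|M. \<bar>g x\<bar> powr q)) < r" by blast
  qed
qed

section \<open>Differentiation of power integrals along lines\<close>

text \<open>Away from 0 the absolute value is removed locally. At 0 the difference quotient is
  bounded by \<open>\<bar>h\<bar> powr (q - 1)\<close>, which tends to 0 because
  \<open>1 < q\<close>; the stated derivative is 0 there also for \<open>q < 2\<close>, thanks to
  the factor \<open>a\<close>.\<close>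

lemma has_real_derivative_abs_powr:
  fixes a q :: real
  assumes q: "1 < q"
  shows "((\<lambda>x. \<bar>x\<bar> powr q) has_real_derivative q * (\<bar>a\<bar> powr (q - 2) * a)) (at a)"
proof -
  have pw: "t powr (q - 2) * t = t powr (q - 1)" if "0 < t" for t :: real
    using that powr_mult_base[of t "q - 2"] by (simp add: mult.commute)
  consider "a > 0" | "a < 0" | "a = 0" by linarith
  then show ?thesis
  proof cases
    case 1
    have "((\<lambda>x. x powr q) has_real_derivative q * (\<bar>a\<bar> powr (q - 2) * a)) (at a)"
      using 1 pw by (auto intro!: derivative_eq_intros)
    then show ?thesis
      by (rule DERIV_cong_ev[THEN iffD1, rotated -1])
        (use 1 in \<open>auto intro: eventually_mono[OF eventually_nhds_in_open[of "{0<..}"]]\<close>)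
  next
    case 2
    have "((\<lambda>x. (- x) powr q) has_real_derivative q * (\<bar>a\<bar> powr (q - 2) * a)) (at a)"
      using 2 by (auto intro!: derivative_eq_intros simp: pw[of "- a", simplified, symmetric])
    then show ?thesis
      by (rule DERIV_cong_ev[THEN iffD1, rotated -1])
        (use 2 in \<open>auto intro: eventually_mono[OF eventually_nhds_in_open[of "{..<0}"]]\<close>)
  next
    case 3
    have "((\<lambda>h. \<bar>h\<bar> powr (q - 1)) \<longlongrightarrow> \<bar>0\<bar> powr (q - 1)) (at (0::real))"
      using q by (intro tendsto_powr2 tendsto_rabs tendsto_ident_at) auto
    then have "((\<lambda>h. \<bar>h\<bar> powr (q - 1)) \<longlongrightarrow> 0) (at (0::real))" using q by simp
    then have "((\<lambda>h. \<bar>h\<bar> powr q / h) \<longlongrightarrow> 0) (at (0::real))"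
    proof (rule Lim_null_comparison[rotated], intro always_eventually allI)
      fix h :: real
      show "norm (\<bar>h\<bar> powr q / h) \<le> \<bar>h\<bar> powr (q - 1)"
        using powr_mult_base[of "\<bar>h\<bar>" "q - 1"] by (cases "h = 0") (auto simp: field_simps)
    qed
    then show ?thesis using 3 q by (simp add: DERIV_def)
  qed
qed

text \<open>Differentiation under the integral sign. It is stated for an arbitrary measure so that
  it serves the mass, the potential and, via difference quotients on the product space, the
  energy.\<close>

lemma has_real_derivative_integral_abs_powr:
  fixes f g :: "'a \<Rightarrow> real"
  assumes [measurable]: "f \<in> borel_measurable M" "g \<in> borel_measurable M"
    and f: "integrable M (\<lambda>x. \<bar>f x\<bar> powr q)" and g: "integrable M (\<lambda>x. \<bar>g x\<bar> powr q)" and q: "1 < q"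
  shows "((\<lambda>t. LINT x|M. \<bar>f x + t * g x\<bar> powr q) has_real_derivative
    q * (LINT x|M. \<bar>f x\<bar> powr (q - 2) * f x * g x)) (at 0)"
proof -
  have it: "integrable M (\<lambda>x. \<bar>f x + t * g x\<bar> powr q)" for t
    using q by (intro integrable_powr_add integrable_powr_scale f g) auto
  define w where "w x = q * 2 powr q * (\<bar>f x\<bar> powr q + \<bar>g x\<bar> powr q)" for x
  have w: "integrable M w" unfolding w_def using f g by simp
  have le: "\<bar>(\<bar>f x + t * g x\<bar> powr q - \<bar>f x\<bar> powr q) / t\<bar> \<le> w x" if t: "\<bar>t\<bar> \<le> 1" "t \<noteq> 0" for t x
  proof -
    let ?m = "\<bar>f x\<bar> + \<bar>g x\<bar>"
    have m: "?m powr (q - 1) * ?m = ?m powr q"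
      using powr_mult_base[of ?m "q - 1"] by (simp add: mult.commute)
    have tg: "\<bar>t * g x\<bar> \<le> \<bar>g x\<bar>" using t by (simp add: abs_mult mult_left_le_one_le)
    have tm: "\<bar>t * g x\<bar> \<le> \<bar>t\<bar> * ?m" by (simp add: abs_mult mult_left_mono)
    have "\<bar>\<bar>f x + t * g x\<bar> powr q - \<bar>f x\<bar> powr q\<bar>
        \<le> q * (\<bar>f x\<bar> + \<bar>t * g x\<bar>) powr (q - 1) * \<bar>t * g x\<bar>"
      using q by (intro abs_powr_diff_bound) simp
    also have "\<dots> \<le> q * ?m powr (q - 1) * (\<bar>t\<bar> * ?m)"
      using q tg tm by (intro mult_mono powr_mono2) simp_all
    also have "\<dots> = \<bar>t\<bar> * (q * ?m powr q)" by (simp only: m[symmetric] mult_ac)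
    also have "q * ?m powr q \<le> w x"
      using abs_add_powr_le[of q "\<bar>f x\<bar>" "\<bar>g x\<bar>"] q
      unfolding w_def mult.assoc by (intro mult_left_mono) simp_all
    then have "\<bar>t\<bar> * (q * ?m powr q) \<le> \<bar>t\<bar> * w x" by (rule mult_left_mono) simp
    finally show ?thesis using t by (simp add: abs_divide field_simps)
  qed
  have "((\<lambda>t. ((LINT x|M. \<bar>f x + t * g x\<bar> powr q) - (LINT x|M. \<bar>f x\<bar> powr q)) / t) \<longlongrightarrow>
    (LINT x|M. q * (\<bar>f x\<bar> powr (q - 2) * f x * g x))) (at 0)"
    unfolding tendsto_at_iff_sequentially comp_def
  proof (intro allI impI)
    fix X :: "nat \<Rightarrow> real" assume X: "\<forall>i. X i \<in> UNIV - {0}" "X \<longlonglongrightarrow> 0"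
    have "\<forall>\<^sub>F k in sequentially. \<bar>X k\<bar> < 1"
      using X(2) by (intro order_tendstoD(2)[OF tendsto_rabs_zero]) auto
    \<comment> \<open>The majorant \<open>w\<close> is valid for increments of size at most 1, so an
      initial segment of the sequence is dropped.\<close>
    then obtain N where N: "\<And>k. N \<le> k \<Longrightarrow> \<bar>X k\<bar> < 1" by (auto simp: eventually_sequentially)
    have "(\<lambda>k. LINT x|M. (\<bar>f x + X (k + N) * g x\<bar> powr q - \<bar>f x\<bar> powr q) / X (k + N))
       \<longlonglongrightarrow> (LINT x|M. q * (\<bar>f x\<bar> powr (q - 2) * f x * g x))"
    proof (rule integral_dominated_convergence[where w = w])
      show "AE x in M. (\<lambda>k. (\<bar>f x + X (k + N) * g x\<bar> powr q - \<bar>f x\<bar> powr q) / X (k + N))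
         \<longlonglongrightarrow> q * (\<bar>f x\<bar> powr (q - 2) * f x * g x)"
      proof (rule AE_I2)
        fix x
        have "((\<lambda>t. \<bar>t\<bar> powr q) has_real_derivative q * (\<bar>f x\<bar> powr (q - 2) * f x)) (at (f x + 0 * g x))"
          using has_real_derivative_abs_powr[OF q, of "f x"] by simp
        then have "((\<lambda>t. \<bar>f x + t * g x\<bar> powr q) has_real_derivative
            q * (\<bar>f x\<bar> powr (q - 2) * f x) * g x) (at 0)"
          by (rule DERIV_chain2) (auto intro!: derivative_eq_intros)
        then have "((\<lambda>t. (\<bar>f x + t * g x\<bar> powr q - \<bar>f x\<bar> powr q) / t) \<longlongrightarrow>
            q * (\<bar>f x\<bar> powr (q - 2) * f x) * g x) (at 0)"
          by (simp add: DERIV_def)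
        moreover have "filterlim (\<lambda>k. X (k + N)) (at 0) sequentially"
          using X LIMSEQ_ignore_initial_segment[OF X(2)] by (intro filterlim_atI) auto
        ultimately show "(\<lambda>k. (\<bar>f x + X (k + N) * g x\<bar> powr q - \<bar>f x\<bar> powr q) / X (k + N))
         \<longlonglongrightarrow> q * (\<bar>f x\<bar> powr (q - 2) * f x * g x)"
          by (auto dest: filterlim_compose simp: mult.assoc)
      qed
      show "AE x in M. norm ((\<bar>f x + X (k + N) * g x\<bar> powr q - \<bar>f x\<bar> powr q) / X (k + N)) \<le> w x" for k
        using le[of "X (k + N)"] N[of "k + N"] X(1) by (intro AE_I2) auto
    qed (use w in auto)
    then have "(\<lambda>k. ((LINT x|M. \<bar>f x + X (k + N) * g x\<bar> powr q) - (LINT x|M. \<bar>f x\<bar> powr q)) / X (k + N))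
       \<longlonglongrightarrow> (LINT x|M. q * (\<bar>f x\<bar> powr (q - 2) * f x * g x))"
      using it f by simp
    then show "(\<lambda>k. ((LINT x|M. \<bar>f x + X k * g x\<bar> powr q) - (LINT x|M. \<bar>f x\<bar> powr q)) / X k)
       \<longlonglongrightarrow> (LINT x|M. q * (\<bar>f x\<bar> powr (q - 2) * f x * g x))"
      by (rule LIMSEQ_offset)
  qed
  then show ?thesis by (simp add: DERIV_def)
qed

text \<open>Integrating \<open>t \<le> \<tau> + \<tau> powr (1 - q) * t powr q\<close> with the optimal \<open>\<tau>\<close> replaces
  Hoelder's inequality, at the cost of the factor 2.\<close>

lemma set_integral_abs_le:
  fixes f :: "'a \<Rightarrow> real"
  assumes [measurable]: "f \<in> borel_measurable M" "B \<in> sets M"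
    and B: "emeasure M B < \<infinity>" "0 < measure M B" and q: "1 < q"
    and int: "integrable M (\<lambda>x. indicator B x * \<bar>f x\<bar> powr q)"
    and le: "(LINT x|M. indicator B x * \<bar>f x\<bar> powr q) \<le> measure M B * K powr q" and K: "0 < K"
  shows "integrable M (\<lambda>x. indicator B x * \<bar>f x\<bar>)"
    and "(LINT x|M. indicator B x * \<bar>f x\<bar>) \<le> 2 * K * measure M B"
proof -
  have pt: "t \<le> K + K powr (1 - q) * t powr q" if t: "0 \<le> t" for t :: real
  proof (cases "t \<le> K")
    case True
    then show ?thesis by (intro order_trans[OF True]) auto
  next
    case False
    then have "t powr (1 - q) \<le> K powr (1 - q)"
      using K q by (intro powr_mono2') auto
    then have "t powr (1 - q) * t powr q \<le> K powr (1 - q) * t powr q"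
      by (intro mult_right_mono) auto
    moreover have "t powr (1 - q) * t powr q = t"
      using False K by (simp flip: powr_add)
    ultimately show ?thesis using K by linarith
  qed
  have iB: "integrable M (\<lambda>x. indicator B x :: real)" using B by (simp add: integrable_indicator_iff)
  have ib: "integrable M (\<lambda>x. K * indicator B x + K powr (1 - q) * (indicator B x * \<bar>f x\<bar> powr q))"
    using int iB by (intro Bochner_Integration.integrable_add integrable_mult_right) auto
  have pt2: "indicator B x * \<bar>f x\<bar> \<le> K * indicator B x + K powr (1 - q) * (indicator B x * \<bar>f x\<bar> powr q)" for x
    using pt[of "\<bar>f x\<bar>"] by (auto simp: indicator_def)
  show i: "integrable M (\<lambda>x. indicator B x * \<bar>f x\<bar>)"
  proof (rule Bochner_Integration.integrable_bound[OF ib])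
    show "AE x in M. norm (indicator B x * \<bar>f x\<bar>)
      \<le> norm (K * indicator B x + K powr (1 - q) * (indicator B x * \<bar>f x\<bar> powr q))"
    proof (rule AE_I2)
      fix x
      have "0 \<le> indicator B x * \<bar>f x\<bar>" by simp
      then show "norm (indicator B x * \<bar>f x\<bar>)
          \<le> norm (K * indicator B x + K powr (1 - q) * (indicator B x * \<bar>f x\<bar> powr q))"
        using pt2[of x] unfolding real_norm_def by linarith
    qed
  qed measurable
  have "(LINT x|M. indicator B x * \<bar>f x\<bar>)
      \<le> (LINT x|M. K * indicator B x + K powr (1 - q) * (indicator B x * \<bar>f x\<bar> powr q))"
    using pt2 by (intro integral_mono i ib)
  also have "\<dots> = K * measure M B + K powr (1 - q) * (LINT x|M. indicator B x * \<bar>f x\<bar> powr q)"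
    using int iB sets.sets_into_space[of B M] by (simp add: Int_absorb1)
  also have "\<dots> \<le> K * measure M B + K powr (1 - q) * (measure M B * K powr q)"
    using le by (intro add_left_mono mult_left_mono) auto
  also have "\<dots> = 2 * K * measure M B"
    using K by (simp add: powr_diff)
  finally show "(LINT x|M. indicator B x * \<bar>f x\<bar>) \<le> 2 * K * measure M B" .
qed

section \<open>Borel representatives and scaling\<close>

lemma
  fixes f :: "'a::euclidean_space \<Rightarrow> real"
  assumes [measurable]: "f \<in> borel_measurable borel" and c: "0 < c"
  shows lborel_integrable_affine_iff: "integrable lborel (\<lambda>x. f (t + c *\<^sub>R x)) \<longleftrightarrow> integrable lborel f"
    and lborel_integral_affine: "(LINT x|lborel. f (t + c *\<^sub>R x)) = (LINT x|lborel. f x) / c ^ DIM('a)"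
proof -
  define k where "k = c ^ DIM('a)"
  have k: "0 < k" using c by (simp add: k_def)
  have L: "lborel = density (distr lborel borel (\<lambda>x::'a. t + c *\<^sub>R x)) (\<lambda>_. ennreal k)"
    using lborel_affine[of c t] c by (simp add: k_def)
  have "integrable lborel f \<longleftrightarrow> integrable lborel (\<lambda>x. k * f (t + c *\<^sub>R x))"
    using k by (subst L) (simp add: integrable_density integrable_distr_eq)
  then show "integrable lborel (\<lambda>x. f (t + c *\<^sub>R x)) \<longleftrightarrow> integrable lborel f"
    using k by simp
  have "(LINT x|lborel. f x) = k * (LINT x|lborel. f (t + c *\<^sub>R x))"
    using k by (subst L) (simp add: integral_density integral_distr)
  then show "(LINT x|lborel. f (t + c *\<^sub>R x)) = (LINT x|lborel. f x) / c ^ DIM('a)"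
    using k unfolding k_def[symmetric] by (simp add: field_simps)
qed

lemma AE_lborel_affine:
  fixes t :: "'a::euclidean_space"
  assumes ae: "AE x in lborel. P x" and c: "0 < c"
  shows "AE x in lborel. P (t + c *\<^sub>R x)"
proof -
  have L: "lborel = density (distr lborel borel (\<lambda>x::'a. t + c *\<^sub>R x)) (\<lambda>_. ennreal (c ^ DIM('a)))"
    using lborel_affine[of c t] c by simp
  have "AE x in distr lborel borel (\<lambda>x::'a. t + c *\<^sub>R x). P x"
    using ae c by (subst (asm) L) (simp add: AE_density)
  then show ?thesis by (rule AE_distrD[rotated]) simp
qed

lemma borel_measurable_prod_fst:
  fixes u :: "'a::euclidean_space \<Rightarrow> real"
  assumes [measurable]: "u \<in> borel_measurable borel"
  shows "(\<lambda>z :: 'a \<times> 'b::euclidean_space. u (fst z)) \<in> borel_measurable borel"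
  by (rule measurable_compose[OF _ assms]) (intro borel_measurable_continuous_onI continuous_intros)

lemma borel_measurable_prod_snd:
  fixes u :: "'b::euclidean_space \<Rightarrow> real"
  assumes [measurable]: "u \<in> borel_measurable borel"
  shows "(\<lambda>z :: 'a::euclidean_space \<times> 'b. u (snd z)) \<in> borel_measurable borel"
  by (rule measurable_compose[OF _ assms]) (intro borel_measurable_continuous_onI continuous_intros)

lemma AE_lborel_prod:
  fixes P :: "'a::euclidean_space \<Rightarrow> bool" and Q :: "'b::euclidean_space \<Rightarrow> bool"
  assumes P: "AE x in lborel. P x" and Q: "AE y in lborel. Q y"
  shows "AE z in lborel. P (fst z) \<and> Q (snd z)"
proof -
  obtain A where A: "A \<in> null_sets lborel" "{x. \<not> P x} \<subseteq> A"
    using P by (auto simp: eventually_ae_filter)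
  obtain B where B: "B \<in> null_sets lborel" "{x. \<not> Q x} \<subseteq> B"
    using Q by (auto simp: eventually_ae_filter)
  have "A \<times> UNIV \<in> null_sets (lborel \<Otimes>\<^sub>M (lborel :: 'b measure))"
    using A by (auto simp: null_sets_def lborel.emeasure_pair_measure_Times)
  moreover have "UNIV \<times> B \<in> null_sets ((lborel :: 'a measure) \<Otimes>\<^sub>M lborel)"
    using B by (auto simp: null_sets_def lborel.emeasure_pair_measure_Times)
  ultimately have "A \<times> UNIV \<union> UNIV \<times> B \<in> null_sets lborel"
    by (auto simp: lborel_prod)
  then show ?thesis using A B by (auto intro!: AE_I')
qed

lemma ex_dyadic_ge_1:
  fixes t :: real
  assumes "1 \<le> t"
  obtains k :: nat where "2 powr k \<le> t" "t < 2 powr (k + 1)"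
proof -
  define k where "k = nat \<lfloor>log 2 t\<rfloor>"
  have "0 \<le> log 2 t" using assms by simp
  then have "real k \<le> log 2 t" "log 2 t < real k + 1" unfolding k_def by linarith+
  then have "2 powr k \<le> t" "t < 2 powr (k + 1)"
    using assms by (simp_all add: le_log_iff log_less_iff add.commute)
  then show ?thesis by (rule that)
qed

locale fractional_sobolev =
  fixes s p n q :: real and dims :: "'n::finite itself"
  assumes s_pos: "0 < s" and p_gt_1: "1 < p" and sp_less: "s * p < n"
    and n_eq: "n = real CARD('n)" and q_def: "q = critical_exponent CARD('n) s p"
begin

abbreviation energy :: "(real ^ 'n \<Rightarrow> real) \<Rightarrow> real" where "energy \<equiv> gagliardo_energy s p"

definition mass :: "(real ^ 'n \<Rightarrow> real) \<Rightarrow> real" where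
  "mass u = (LINT x|lborel. \<bar>u x\<bar> powr q)"

text \<open>The exponent \<open>n / p + s\<close> turns the \<open>p\<close>-th power into the
  Gagliardo integrand. As \<open>diff_quot\<close> is linear in \<open>u\<close>, the energy becomes
  a plain power integral on the product space, to which Brezis--Lieb, Fatou and the differentiation
  lemma apply directly.\<close>

definition diff_quot :: "(real ^ 'n \<Rightarrow> real) \<Rightarrow> (real ^ 'n) \<times> (real ^ 'n) \<Rightarrow> real" where
  "diff_quot u z = (u (fst z) - u (snd z)) / norm (fst z - snd z) powr (n / p + s)"

definition borel_Dsp :: "(real ^ 'n \<Rightarrow> real) set" where
  "borel_Dsp = {u \<in> borel_measurable borel. integrable lborel (\<lambda>x. \<bar>u x\<bar> powr q) \<and>
     integrable lborel (\<lambda>z. \<bar>diff_quot u z\<bar> powr p)}"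

lemma n_pos: "0 < n" by (simp add: n_eq)

lemma q_eq: "q = n * p / (n - s * p)" by (simp add: q_def critical_exponent_def n_eq)

lemma q_gt_p: "p < q" and q_gt_1: "1 < q"
proof -
  have "p * (n - s * p) < n * p" using s_pos p_gt_1 by (simp add: algebra_simps)
  then show "p < q" using sp_less by (simp add: q_eq field_simps)
  then show "1 < q" using p_gt_1 by simp
qed

text \<open>The decay exponent for which a dilation preserves mass and energy at once:
  \<open>n / q * p\<close> cancels the exponent \<open>s * p - n\<close> of the energy.\<close>

lemma n_div_q: "n / q = (n - s * p) / p"
  using n_pos by (simp add: q_eq)

lemma diff_quot_powr: "\<bar>diff_quot u z\<bar> powr p = gagliardo_integrand s p u z"
proof -
  have e: "(n / p + s) * p = n + s * p" using p_gt_1 by (simp add: algebra_simps)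
  show ?thesis
    unfolding gagliardo_integrand_def diff_quot_def
    by (simp add: case_prod_beta abs_divide powr_divide powr_powr e flip: n_eq)
qed

lemma borel_DspD [measurable_dest]: "u \<in> borel_Dsp \<Longrightarrow> u \<in> borel_measurable borel"
  and borel_Dsp_mass: "u \<in> borel_Dsp \<Longrightarrow> integrable lborel (\<lambda>x. \<bar>u x\<bar> powr q)"
  and borel_Dsp_diff_quot: "u \<in> borel_Dsp \<Longrightarrow> integrable lborel (\<lambda>z. \<bar>diff_quot u z\<bar> powr p)"
  by (auto simp: borel_Dsp_def)

lemma borel_measurable_diff_quot [measurable]:
  assumes [measurable]: "u \<in> borel_measurable borel"
  shows "diff_quot u \<in> borel_measurable borel"
proof -
  note [measurable] = borel_measurable_prod_fst[of u] borel_measurable_prod_snd[of u]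
  have [measurable]: "(\<lambda>z :: (real ^ 'n) \<times> (real ^ 'n). norm (fst z - snd z)) \<in> borel_measurable borel"
    by (intro borel_measurable_continuous_onI continuous_intros)
  show ?thesis unfolding diff_quot_def[abs_def] by measurable
qed

lemma energy_eq:
  assumes [measurable]: "u \<in> borel_measurable borel"
  shows "energy u = (LINT z|lborel. \<bar>diff_quot u z\<bar> powr p)"
  unfolding gagliardo_energy_def diff_quot_powr[symmetric]
  by (rule integral_completion) measurable

lemma energy_nonneg: "0 \<le> energy u"
  unfolding gagliardo_energy_def gagliardo_integrand_def
  by (intro integral_nonneg_AE AE_I2) (auto split: prod.split)

lemma mass_nonneg: "0 \<le> mass u"
  unfolding mass_def by (intro integral_nonneg_AE AE_I2) auto

lemma borel_Dsp_subset: "borel_Dsp \<subseteq> Dsp s p"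
proof
  fix u assume u: "u \<in> borel_Dsp"
  note [measurable] = borel_DspD[OF u]
  have "integrable lebesgue (\<lambda>x. \<bar>u x\<bar> powr q)"
    using borel_Dsp_mass[OF u] by (subst integrable_completion) measurable
  moreover have "integrable lebesgue (\<lambda>z. \<bar>diff_quot u z\<bar> powr p)"
    using borel_Dsp_diff_quot[OF u] by (subst integrable_completion) measurable
  moreover have "u \<in> borel_measurable lebesgue"
    by (rule measurable_completion) measurable
  ultimately show "u \<in> Dsp s p"
    by (simp add: Dsp_def Lp_space_def diff_quot_powr flip: q_def)
qed

lemma diff_quot_add: "diff_quot (\<lambda>x. u x + v x) z = diff_quot u z + diff_quot v z"
  and diff_quot_diff: "diff_quot (\<lambda>x. u x - v x) z = diff_quot u z - diff_quot v z"
  and diff_quot_scale: "diff_quot (\<lambda>x. c * u x) z = c * diff_quot u z"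
  by (simp_all add: diff_quot_def add_divide_distrib diff_divide_distrib algebra_simps)

lemma AE_diff_quot_tendsto:
  assumes conv: "AE x in lborel. (\<lambda>k. f k x) \<longlonglongrightarrow> g x"
  shows "AE z in lborel. (\<lambda>k. diff_quot (f k) z) \<longlonglongrightarrow> diff_quot g z"
  using AE_lborel_prod[OF conv conv]
  by eventually_elim (auto simp: diff_quot_def divide_inverse intro!: tendsto_mult tendsto_diff)

lemma borel_Dsp_scale:
  assumes "u \<in> borel_Dsp" shows "(\<lambda>x. c * u x) \<in> borel_Dsp"
  unfolding borel_Dsp_def mem_Collect_eq diff_quot_scale
  using borel_DspD[OF assms] borel_Dsp_mass[OF assms] borel_Dsp_diff_quot[OF assms]
  by (intro conjI integrable_powr_scale) measurable

lemma borel_Dsp_add: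
  assumes u: "u \<in> borel_Dsp" and v: "v \<in> borel_Dsp" shows "(\<lambda>x. u x + v x) \<in> borel_Dsp"
proof -
  note [measurable] = borel_DspD[OF u] borel_DspD[OF v]
  have "integrable lborel (\<lambda>x. \<bar>u x + v x\<bar> powr q)"
    using q_gt_1 by (intro integrable_powr_add borel_Dsp_mass u v) auto
  moreover have "integrable lborel (\<lambda>z. \<bar>diff_quot u z + diff_quot v z\<bar> powr p)"
    using p_gt_1 by (intro integrable_powr_add borel_Dsp_diff_quot u v) auto
  ultimately show ?thesis by (auto simp: borel_Dsp_def diff_quot_add)
qed

lemma borel_Dsp_diff:
  assumes u: "u \<in> borel_Dsp" and v: "v \<in> borel_Dsp" shows "(\<lambda>x. u x - v x) \<in> borel_Dsp"
  using borel_Dsp_add[OF u borel_Dsp_scale[OF v, of "- 1"]] by simp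

lemma mass_scale: "mass (\<lambda>x. c * u x) = \<bar>c\<bar> powr q * mass u"
  by (simp add: mass_def abs_mult powr_mult)

lemma energy_scale:
  assumes [measurable]: "u \<in> borel_measurable borel"
  shows "energy (\<lambda>x. c * u x) = \<bar>c\<bar> powr p * energy u"
  by (simp add: energy_eq diff_quot_scale abs_mult powr_mult)

lemma powr_n: "0 < c \<Longrightarrow> c powr n = c ^ CARD('n)"
  by (simp add: powr_realpow n_eq)

lemma diff_quot_affine:
  assumes c: "0 < c"
  shows "\<bar>diff_quot (\<lambda>y. u (t + c *\<^sub>R y)) z\<bar> powr p
    = c powr (n + s * p) * \<bar>diff_quot u ((t, t) + c *\<^sub>R z)\<bar> powr p"
proof -
  have "norm (t + c *\<^sub>R fst z - (t + c *\<^sub>R snd z)) = c * norm (fst z - snd z)"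
    using c by (simp flip: scaleR_diff_right)
  then show ?thesis
    using c by (simp add: diff_quot_powr gagliardo_integrand_def case_prod_beta powr_mult flip: n_eq)
qed

lemma
  assumes [measurable]: "u \<in> borel_measurable borel" and c: "0 < c"
  shows mass_affine: "mass (\<lambda>y. u (t + c *\<^sub>R y)) = c powr (- n) * mass u"
    and energy_affine: "energy (\<lambda>y. u (t + c *\<^sub>R y)) = c powr (s * p - n) * energy u"
    and borel_Dsp_affine: "u \<in> borel_Dsp \<Longrightarrow> (\<lambda>y. u (t + c *\<^sub>R y)) \<in> borel_Dsp"
proof -
  show "mass (\<lambda>y. u (t + c *\<^sub>R y)) = c powr (- n) * mass u"
    unfolding mass_def using c
    by (subst lborel_integral_affine[where f="\<lambda>x. \<bar>u x\<bar> powr q"])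
      (simp_all add: powr_minus powr_n[OF c] divide_inverse mult.commute)
  have "energy (\<lambda>y. u (t + c *\<^sub>R y))
      = c powr (n + s * p) * (LINT z|lborel. \<bar>diff_quot u ((t, t) + c *\<^sub>R z)\<bar> powr p)"
    by (subst energy_eq) (simp_all add: diff_quot_affine[OF c])
  also have "\<dots> = c powr (n + s * p) * (energy u / c ^ DIM((real ^ 'n) \<times> (real ^ 'n)))"
    using c by (subst lborel_integral_affine[where f="\<lambda>z. \<bar>diff_quot u z\<bar> powr p"])
      (auto simp: energy_eq)
  \<comment> \<open>Dilating both variables gives the Jacobian exponent \<open>2 * n\<close>; the
    shift on the product space is the diagonal one, by \<open>(t, t)\<close>.\<close>
  also have "c ^ DIM((real ^ 'n) \<times> (real ^ 'n)) = c powr (2 * n)"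
    using c by (subst powr_realpow[symmetric]) (simp_all add: n_eq)
  also have "c powr (n + s * p) * (energy u / c powr (2 * n)) = c powr (s * p - n) * energy u"
  proof -
    have "c powr (s * p - n) = c powr (n + s * p) / c powr (2 * n)"
      by (subst powr_diff[symmetric]) simp
    then show ?thesis by simp
  qed
  finally show "energy (\<lambda>y. u (t + c *\<^sub>R y)) = c powr (s * p - n) * energy u" .
  assume u: "u \<in> borel_Dsp"
  have "integrable lborel (\<lambda>x. \<bar>u (t + c *\<^sub>R x)\<bar> powr q)"
    using c borel_Dsp_mass[OF u]
    by (subst lborel_integrable_affine_iff[where f="\<lambda>x. \<bar>u x\<bar> powr q"]) auto
  moreover have "integrable lborel (\<lambda>z. \<bar>diff_quot u ((t, t) + c *\<^sub>R z)\<bar> powr p)"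
    using c borel_Dsp_diff_quot[OF u]
    by (subst lborel_integrable_affine_iff[where f="\<lambda>z. \<bar>diff_quot u z\<bar> powr p"]) auto
  ultimately show "(\<lambda>y. u (t + c *\<^sub>R y)) \<in> borel_Dsp"
    by (auto simp: borel_Dsp_def diff_quot_affine[OF c])
qed

section \<open>Sobolev inequalities\<close>

definition omega :: real where "omega = measure lborel (ball (0 :: real ^ 'n) 1)"

lemma omega_pos: "0 < omega"
  using content_ball_pos[of 1 "0 :: real ^ 'n"] by (simp add: omega_def)

lemma measure_ball:
  fixes x :: "real ^ 'n"
  assumes "0 < r"
  shows "measure lborel (ball x r) = omega * r powr n"
  using assms content_ball_conv_unit_ball[of r x]
  by (simp add: omega_def powr_n mult.commute)

lemma ball_facts:
  fixes x :: "real ^ 'n"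
  assumes "0 < r"
  shows "emeasure lborel (ball x r) < \<infinity>" "0 < measure lborel (ball x r)"
  using emeasure_lborel_ball_finite[of x r] assms omega_pos by (auto simp: measure_ball)

lemma integrable_indicator_mult:
  fixes f :: "real ^ 'n \<Rightarrow> real"
  assumes "integrable lborel f"
  shows "integrable lborel (\<lambda>y. indicator (ball x r) y * f y)"
  using integrable_mult_indicator[of "ball x r" lborel f] assms by simp

text \<open>The point value is compared with the mean over \<open>ball x r\<close>; the radius equating the two
  resulting terms turns the bound into a multiple of \<open>d powr (1 / q)\<close>.\<close>

lemma morrey_pointwise:
  fixes u :: "real ^ 'n \<Rightarrow> real"
  assumes [measurable]: "u \<in> borel_measurable borel"
    and int: "integrable lborel (\<lambda>y. \<bar>diff_quot u (x, y)\<bar> powr p)"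
    and d: "(LINT y|lborel. \<bar>diff_quot u (x, y)\<bar> powr p) \<le> d" "0 < d" and M: "0 < M"
    and loc: "\<And>r. 0 < r \<Longrightarrow> integrable lborel (\<lambda>y. indicator (ball x r) y * \<bar>u y\<bar>)"
    and mor: "\<And>r. 0 < r \<Longrightarrow> (LINT y|lborel. indicator (ball x r) y * \<bar>u y\<bar>)
      \<le> M * r powr (- n / q) * (omega * r powr n)"
  shows "\<bar>u x\<bar> powr q \<le> (2 * omega powr (- 1 / p) + 1) powr q * M powr (q - p) * d"
proof -
  define r where "r = (M / d powr (1 / p)) powr (p / n)"
  have r: "0 < r" using M d by (simp add: r_def)
  \<comment> \<open>Solves \<open>r powr (n + s * p) * d = measure lborel ?B * K powr p\<close>, so
    that \<open>2 * K\<close> bounds the mean of \<open>\<bar>u x - u y\<bar>\<close> over the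
    ball.\<close>
  define K where "K = (r powr (s * p) * d / omega) powr (1 / p)"
  have K: "0 < K" using r d omega_pos by (simp add: K_def)
  let ?B = "ball x r"
  have [measurable]: "?B \<in> sets borel" by simp
  have le: "indicator ?B y * \<bar>u x - u y\<bar> powr p \<le> r powr (n + s * p) * \<bar>diff_quot u (x, y)\<bar> powr p" for y
  proof (cases "y \<in> ?B \<and> y \<noteq> x")
    case True
    then have nz: "0 < norm (x - y)" "norm (x - y) \<le> r" by (auto simp: dist_norm)
    have "norm (x - y) powr (n + s * p) \<le> r powr (n + s * p)"
      using nz n_pos s_pos p_gt_1 by (intro powr_mono2) auto
    then have "\<bar>u x - u y\<bar> powr p * norm (x - y) powr (n + s * p) \<le> \<bar>u x - u y\<bar> powr p * r powr (n + s * p)"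
      by (intro mult_left_mono) auto
    then show ?thesis
      using nz True unfolding diff_quot_powr gagliardo_integrand_def
      by (simp add: pos_le_divide_eq mult.commute flip: n_eq)
  next
    case False
    then show ?thesis by (cases "y = x") (auto simp: indicator_def)
  qed
  have intd: "integrable lborel (\<lambda>y. indicator ?B y * \<bar>u x - u y\<bar> powr p)"
  proof (rule Bochner_Integration.integrable_bound)
    show "integrable lborel (\<lambda>y. r powr (n + s * p) * \<bar>diff_quot u (x, y)\<bar> powr p)"
      using int by simp
    show "AE y in lborel. norm (indicator ?B y * \<bar>u x - u y\<bar> powr p)
        \<le> norm (r powr (n + s * p) * \<bar>diff_quot u (x, y)\<bar> powr p)"
      using le by (intro AE_I2) simp
  qed measurable
  have "(LINT y|lborel. indicator ?B y * \<bar>u x - u y\<bar> powr p)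
      \<le> (LINT y|lborel. r powr (n + s * p) * \<bar>diff_quot u (x, y)\<bar> powr p)"
    using le int intd by (intro integral_mono) auto
  also have "\<dots> \<le> r powr (n + s * p) * d" using d by (simp add: mult_left_mono)
  also have "\<dots> = measure lborel ?B * K powr p"
  proof -
    have "K powr p = r powr (s * p) * d / omega"
      using p_gt_1 r d omega_pos by (simp add: K_def powr_powr)
    then show ?thesis using omega_pos r by (simp add: measure_ball powr_add)
  qed
  finally have le1: "(LINT y|lborel. indicator ?B y * \<bar>u x - u y\<bar> powr p) \<le> measure lborel ?B * K powr p" .
  note H = set_integral_abs_le[of "\<lambda>y. u x - u y" lborel ?B p K, OF _ _ ball_facts[OF r] p_gt_1 intd le1 K]
  have int_c: "integrable lborel (\<lambda>y. indicator ?B y * \<bar>u x\<bar>)"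
    using ball_facts[OF r, of x] by simp
  have "\<bar>u x\<bar> * measure lborel ?B = (LINT y|lborel. indicator ?B y * \<bar>u x\<bar>)"
    by simp
  also have "\<dots> \<le> (LINT y|lborel. indicator ?B y * \<bar>u x - u y\<bar> + indicator ?B y * \<bar>u y\<bar>)"
    using H(1) loc[OF r] int_c
    by (intro integral_mono) (auto simp: indicator_def)
  also have "\<dots> = (LINT y|lborel. indicator ?B y * \<bar>u x - u y\<bar>) + (LINT y|lborel. indicator ?B y * \<bar>u y\<bar>)"
    using H(1) loc[OF r] by simp
  also have "\<dots> \<le> 2 * K * measure lborel ?B + M * r powr (- n / q) * measure lborel ?B"
    using H(2) mor[OF r] by (simp add: measure_ball[OF r])
  finally have "\<bar>u x\<bar> * measure lborel ?B \<le> (2 * K + M * r powr (- n / q)) * measure lborel ?B"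
    by (simp add: distrib_right)
  then have main: "\<bar>u x\<bar> \<le> 2 * K + M * r powr (- n / q)"
    using ball_facts[OF r, of x] by simp
  \<comment> \<open>At the chosen radius both terms are multiples of \<open>T\<close>, which is
    verified by comparing logarithms of positive numbers. Its \<open>q\<close>-th power is
    \<open>M powr (q - p) * d\<close> because \<open>s * p / n * q = q - p\<close>.\<close>
  define T where "T = M powr (s * p / n) * d powr (1 / q)"
  have lnr: "ln r = p / n * (ln M - ln d / p)"
    using M d by (simp add: r_def ln_powr ln_div)
  have np: "n \<noteq> 0" "p \<noteq> 0" "q \<noteq> 0" using n_pos p_gt_1 q_gt_1 by auto
  have qi: "1 / q = 1 / p - s / n" using np sp_less by (simp add: q_eq field_simps)
  have "K = omega powr (- 1 / p) * T"
  proof -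
    have "ln K = ln (omega powr (- 1 / p) * T)"
      using r d omega_pos M np
      by (simp add: K_def T_def ln_powr ln_mult ln_div lnr qi) (simp add: field_simps)
    then show ?thesis using K M d omega_pos by (simp add: T_def)
  qed
  moreover have "M * r powr (- n / q) = T"
  proof -
    have e: "n / q = n / p - s" using np qi by (simp add: field_simps)
    have "ln (M * r powr (- n / q)) = ln T"
      using r d M np
      by (simp add: T_def ln_powr ln_mult lnr qi e) (simp add: field_simps)
    then show ?thesis using r M d by (simp add: T_def)
  qed
  ultimately have "\<bar>u x\<bar> \<le> (2 * omega powr (- 1 / p) + 1) * T" using main by (simp add: distrib_right)
  then have "\<bar>u x\<bar> powr q \<le> ((2 * omega powr (- 1 / p) + 1) * T) powr q"
    using q_gt_1 by (intro powr_mono2) auto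
  also have "\<dots> = (2 * omega powr (- 1 / p) + 1) powr q * T powr q"
    by (rule powr_mult)
  also have "T powr q = M powr (s * p / n * q) * d powr (1 / q * q)"
    by (simp add: T_def powr_mult powr_powr)
  also have "s * p / n * q = q - p"
    using np sp_less by (simp add: q_eq field_simps)
  also have "d powr (1 / q * q) = d" using np d by simp
  finally show ?thesis by (simp add: mult.assoc)
qed

text \<open>Hoelder on a ball: bounded mass alone bounds all scaled means. This provides a first
  admissible \<open>M\<close> for \<open>improved_sobolev\<close>, as well as local
  integrability.\<close>

lemma mass_ball_bound:
  assumes u: "u \<in> borel_Dsp" and m: "mass u \<le> m" "0 < m" and r: "0 < r"
  shows "integrable lborel (\<lambda>y. indicator (ball x r) y * \<bar>u y\<bar>)"
    and "(LINT y|lborel. indicator (ball x r) y * \<bar>u y\<bar>)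
      \<le> 2 * (m / omega) powr (1 / q) * r powr (- n / q) * (omega * r powr n)"
proof -
  note [measurable] = borel_DspD[OF u]
  define K where "K = (m / omega) powr (1 / q) * r powr (- n / q)"
  have K: "0 < K" using m r omega_pos by (simp add: K_def)
  have int: "integrable lborel (\<lambda>y. indicator (ball x r) y * \<bar>u y\<bar> powr q)"
    by (intro integrable_indicator_mult borel_Dsp_mass u)
  have "(LINT y|lborel. indicator (ball x r) y * \<bar>u y\<bar> powr q) \<le> mass u"
    unfolding mass_def
    by (intro integral_mono int borel_Dsp_mass u) (auto simp: indicator_def)
  also have "\<dots> \<le> measure lborel (ball x r) * K powr q"
  proof -
    have "K powr q = m / omega * r powr (- n)"
      using q_gt_1 m omega_pos r by (simp add: K_def powr_mult powr_powr)
    then show ?thesis using m omega_pos r by (simp add: measure_ball powr_minus field_simps)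
  qed
  finally have le: "(LINT y|lborel. indicator (ball x r) y * \<bar>u y\<bar> powr q) \<le> measure lborel (ball x r) * K powr q" .
  show "integrable lborel (\<lambda>y. indicator (ball x r) y * \<bar>u y\<bar>)"
    by (rule set_integral_abs_le(1)[OF _ _ ball_facts[OF r] q_gt_1 int le K]) measurable
  have "(LINT y|lborel. indicator (ball x r) y * \<bar>u y\<bar>) \<le> 2 * K * measure lborel (ball x r)"
    by (rule set_integral_abs_le(2)[OF _ _ ball_facts[OF r] q_gt_1 int le K]) measurable
  then show "(LINT y|lborel. indicator (ball x r) y * \<bar>u y\<bar>)
      \<le> 2 * (m / omega) powr (1 / q) * r powr (- n / q) * (omega * r powr n)"
    by (simp add: K_def measure_ball[OF r] mult.assoc)
qed

definition sobolev_const :: real where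
  "sobolev_const = (2 * omega powr (- 1 / p) + 1) powr q"

lemma sobolev_const_pos: "0 < sobolev_const"
proof -
  have "0 < 2 * omega powr (- 1 / p) + 1" using omega_pos by (simp add: add_pos_pos)
  then show ?thesis by (simp add: sobolev_const_def)
qed

text \<open>\<open>morrey_pointwise\<close> with \<open>d\<close> the inner integral of the energy,
  finite for almost every \<open>x\<close> by Fubini, is integrated over \<open>x\<close>. The power
  \<open>q - p\<close> of \<open>M\<close> is positive, so small scaled means force small
  mass.\<close>

lemma improved_sobolev:
  assumes u: "u \<in> borel_Dsp" and M: "0 < M"
    and mor: "\<And>x r. 0 < r \<Longrightarrow> (LINT y|lborel. indicator (ball x r) y * \<bar>u y\<bar>)
      \<le> M * r powr (- n / q) * (omega * r powr n)"
  shows "mass u \<le> sobolev_const * M powr (q - p) * energy u"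
proof -
  note [measurable] = borel_DspD[OF u]
  let ?e = "\<lambda>x. LINT y|lborel. \<bar>diff_quot u (x, y)\<bar> powr p"
  define A where "A = sobolev_const * M powr (q - p)"
  have A: "0 < A" using sobolev_const_pos M by (simp add: A_def)
  have int: "integrable (lborel \<Otimes>\<^sub>M lborel) (\<lambda>z. \<bar>diff_quot u z\<bar> powr p)"
    using borel_Dsp_diff_quot[OF u] by (simp add: lborel_prod)
  have "mass u \<le> (LINT x|lborel. A * ?e x)"
    unfolding mass_def
  proof (rule integral_mono_AE)
    show "integrable lborel (\<lambda>x. A * ?e x)"
      using lborel_pair.integrable_fst'[OF int] by simp
    show "AE x in lborel. \<bar>u x\<bar> powr q \<le> A * ?e x"
      using lborel_pair.AE_integrable_fst'[OF int]
    proof eventually_elim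
      case (elim x)
      show ?case
      \<comment> \<open>The inner integral may vanish while \<open>morrey_pointwise\<close> requires
        \<open>0 < d\<close>; hence the slack \<open>e / A\<close>.\<close>
      proof (rule field_le_epsilon)
        fix e :: real assume e: "0 < e"
        have nn: "0 \<le> ?e x" by (intro integral_nonneg_AE AE_I2) auto
        have ed: "?e x \<le> ?e x + e / A" "0 < ?e x + e / A"
          using e A nn by (auto intro: add_nonneg_pos)
        have "\<bar>u x\<bar> powr q \<le> (2 * omega powr (- 1 / p) + 1) powr q * M powr (q - p) * (?e x + e / A)"
          by (rule morrey_pointwise[OF borel_DspD[OF u] elim ed M])
            (use mass_ball_bound(1)[OF u, of "max 1 (mass u)"] mor in auto)
        also have "\<dots> = A * (?e x + e / A)" by (simp add: A_def sobolev_const_def)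
        also have "\<dots> = A * ?e x + e" using A by (simp add: distrib_left)
        finally show "\<bar>u x\<bar> powr q \<le> A * ?e x + e" .
      qed
    qed
  qed (rule borel_Dsp_mass[OF u])
  also have "\<dots> = A * energy u"
    using lborel_pair.integral_fst'[OF int] by (simp add: energy_eq lborel_prod)
  finally show ?thesis by (simp add: A_def)
qed

text \<open>The usual Sobolev inequality, with \<open>M\<close> supplied by
  \<open>mass_ball_bound\<close> for mass 1.\<close>

lemma sobolev_normalized:
  assumes u: "u \<in> borel_Dsp" and m: "mass u = 1"
  shows "1 \<le> sobolev_const * (2 * omega powr (- 1 / q)) powr (q - p) * energy u"
proof -
  have e: "(1 / omega) powr (1 / q) = omega powr (- 1 / q)"
    using omega_pos by (simp add: powr_divide powr_minus_divide)
  have "mass u \<le> sobolev_const * (2 * omega powr (- 1 / q)) powr (q - p) * energy u"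
    using mass_ball_bound(2)[OF u, of 1] m omega_pos
    by (intro improved_sobolev[OF u]) (auto simp: e)
  then show ?thesis using m by simp
qed

text \<open>If every scaled mean were at most \<open>M\<close>, \<open>improved_sobolev\<close>
  would push the mass below 1. Some ball therefore carries more, and an affine change of variables
  moves it onto \<open>ball x\<^sub>0 rho\<close>. The resulting bound depends on \<open>E0\<close>
  and \<open>rho\<close> but not on \<open>u\<close>.\<close>

lemma concentration:
  fixes x\<^sub>0 :: "real ^ 'n"
  assumes E0: "0 < E0" and rho: "0 < rho"
  obtains M where "0 < M"
    "\<And>u. u \<in> borel_Dsp \<Longrightarrow> mass u = 1 \<Longrightarrow> energy u \<le> E0 \<Longrightarrow>
      \<exists>v\<in>borel_Dsp. mass v = 1 \<and> energy v = energy u \<and>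
        M \<le> (LINT y|lborel. indicator (ball x\<^sub>0 rho) y * \<bar>v y\<bar>)"
proof -
  \<comment> \<open>Makes \<open>sobolev_const * M powr (q - p) * E0\<close> equal to one
    half.\<close>
  define M where "M = (1 / (2 * sobolev_const * E0)) powr (1 / (q - p))"
  have M: "0 < M" using sobolev_const_pos E0 by (simp add: M_def)
  have M_small: "sobolev_const * M powr (q - p) * E0 < 1"
  proof -
    have "M powr (q - p) = 1 / (2 * sobolev_const * E0)"
      using q_gt_p sobolev_const_pos E0 by (simp add: M_def powr_powr)
    then show ?thesis using sobolev_const_pos E0 by simp
  qed
  define M' where "M' = M * rho powr (- n / q) * (omega * rho powr n)"
  show ?thesis
  proof
    show "0 < M'" using M rho omega_pos by (simp add: M'_def)
    fix u assume u: "u \<in> borel_Dsp" "mass u = 1" "energy u \<le> E0"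
    have "\<exists>x r. 0 < r \<and> M * r powr (- n / q) * (omega * r powr n)
        < (LINT y|lborel. indicator (ball x r) y * \<bar>u y\<bar>)"
    proof (rule ccontr)
      assume "\<not> ?thesis"
      then have "mass u \<le> sobolev_const * M powr (q - p) * energy u"
        by (intro improved_sobolev u M) (meson not_less)
      also have "\<dots> \<le> sobolev_const * M powr (q - p) * E0"
        using u sobolev_const_pos by (intro mult_left_mono) auto
      finally show False using M_small u by simp
    qed
    then obtain x r where r: "0 < r" and gt: "M * r powr (- n / q) * (omega * r powr n)
        < (LINT y|lborel. indicator (ball x r) y * \<bar>u y\<bar>)" by blast
    define c where "c = r / rho"
    have c: "0 < c" using r rho by (simp add: c_def)
    \<comment> \<open>With this shift, \<open>y\<close> lies in \<open>ball x\<^sub>0 rho\<close>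
      exactly when \<open>t + c *\<^sub>R y\<close> lies in \<open>ball x r\<close>; the factor
      \<open>b\<close> then restores mass and energy.\<close>
    define t where "t = x - c *\<^sub>R x\<^sub>0"
    define b where "b = c powr (n / q)"
    have b: "0 < b" using c by (simp add: b_def)
    note [measurable] = borel_DspD[OF u(1)]
    define v where "v = (\<lambda>y. b * u (t + c *\<^sub>R y))"
    have "v \<in> borel_Dsp" unfolding v_def by (intro borel_Dsp_scale borel_Dsp_affine c u) measurable
    moreover have "mass v = 1"
    proof -
      have "b powr q * c powr (- n) = 1"
        using c q_gt_1 by (simp add: b_def powr_powr flip: powr_add)
      then show ?thesis unfolding v_def using b c u by (simp add: mass_scale mass_affine)
    qed
    moreover have "energy v = energy u"
    proof -
      have "n / q * p + (s * p - n) = 0" using p_gt_1 by (simp add: n_div_q)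
      then have "b powr p * c powr (s * p - n) = 1"
        using c by (simp add: b_def powr_powr flip: powr_add)
      then show ?thesis unfolding v_def using b c
        by (simp add: energy_scale energy_affine mult.assoc[symmetric])
    qed
    moreover have "M' \<le> (LINT y|lborel. indicator (ball x\<^sub>0 rho) y * \<bar>v y\<bar>)"
    proof -
      have ball: "t + c *\<^sub>R y \<in> ball x r \<longleftrightarrow> y \<in> ball x\<^sub>0 rho" for y
      proof -
        have "dist x (t + c *\<^sub>R y) = c * dist x\<^sub>0 y"
          using c by (simp add: t_def dist_norm flip: scaleR_diff_right)
        then show ?thesis using c rho r by (simp add: c_def pos_divide_less_eq)
      qed
      have [measurable]: "ball x r \<in> sets borel" by simp
      have eq: "indicator (ball x\<^sub>0 rho) y * \<bar>v y\<bar>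
          = b * (indicator (ball x r) (t + c *\<^sub>R y) * \<bar>u (t + c *\<^sub>R y)\<bar>)" for y
        using ball[of y] b by (auto simp: v_def abs_mult indicator_def)
      have "(LINT y|lborel. indicator (ball x\<^sub>0 rho) y * \<bar>v y\<bar>)
          = b * ((LINT y|lborel. indicator (ball x r) y * \<bar>u y\<bar>) / c powr n)"
        unfolding eq using c
        by (subst integral_mult_right_zero,
            subst lborel_integral_affine[where f="\<lambda>y. indicator (ball x r) y * \<bar>u y\<bar>"])
          (simp_all add: powr_n)
      also have "\<dots> \<ge> b * ((M * r powr (- n / q) * (omega * r powr n)) / c powr n)"
        using gt b c by (intro mult_left_mono divide_right_mono) auto
      also have "b * ((M * r powr (- n / q) * (omega * r powr n)) / c powr n) = M'"
      proof -
        have rr: "r = c * rho" using rho by (simp add: c_def)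
        have bc: "b * c powr (- n / q) = 1" using c by (simp add: b_def flip: powr_add)
        have "b * ((M * r powr (- n / q) * (omega * r powr n)) / c powr n)
            = (b * c powr (- n / q)) * (M * rho powr (- n / q) * (omega * rho powr n))"
          using c rho unfolding rr by (simp add: powr_mult)
        then show ?thesis unfolding bc by (simp add: M'_def)
      qed
      finally show ?thesis .
    qed
    ultimately show "\<exists>v\<in>borel_Dsp. mass v = 1 \<and> energy v = energy u \<and>
        M' \<le> (LINT y|lborel. indicator (ball x\<^sub>0 rho) y * \<bar>v y\<bar>)" by blast
  qed
qed

section \<open>Test functions\<close>

text \<open>A dyadic substitute for polar coordinates: \<open>g\<close> lies below the sum of the
  \<open>a k\<close> times indicators of balls, whose integral is a multiple of the given
  series.\<close>

lemma integrable_of_ball_cover: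
  fixes g :: "real ^ 'n \<Rightarrow> real" and r a :: "nat \<Rightarrow> real"
  assumes [measurable]: "g \<in> borel_measurable borel" and g: "\<And>z. 0 \<le> g z"
    and r: "\<And>k. 0 < r k" and a: "\<And>k. 0 \<le> a k"
    and cov: "\<And>z. g z \<noteq> 0 \<Longrightarrow> \<exists>k. norm z < r k \<and> g z \<le> a k"
    and sum: "summable (\<lambda>k. a k * r k powr n)"
  shows "integrable lborel g"
proof (rule integrableI_bounded)
  have ball[measurable]: "ball (0 :: real ^ 'n) e \<in> sets borel" for e by simp
  have "(\<integral>\<^sup>+ z. ennreal (norm (g z)) \<partial>lborel)
      \<le> (\<integral>\<^sup>+ z. (\<Sum>k. ennreal (a k) * indicator (ball (0 :: real ^ 'n) (r k)) z) \<partial>lborel)"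
  proof (rule nn_integral_mono)
    fix z
    show "ennreal (norm (g z)) \<le> (\<Sum>k. ennreal (a k) * indicator (ball 0 (r k)) z)"
    proof (cases "g z = 0")
      case False
      then obtain k where k: "norm z < r k" "g z \<le> a k" using cov by blast
      have "ennreal (norm (g z)) \<le> ennreal (a k) * indicator (ball 0 (r k)) z"
        using k g by (auto intro: ennreal_leI)
      also have "\<dots> \<le> (\<Sum>k. ennreal (a k) * indicator (ball 0 (r k)) z)"
      proof -
        define F :: "nat \<Rightarrow> ennreal" where "F k = ennreal (a k) * indicator (ball 0 (r k)) z" for k
        have "(\<Sum>j\<in>{k}. F j) \<le> (\<Sum>j. F j)" by (rule sum_le_suminf) auto
        then show ?thesis by (simp add: F_def[symmetric])
      qed
      finally show ?thesis .
    qed simp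
  qed
  also have "\<dots> = (\<Sum>k. \<integral>\<^sup>+ z. ennreal (a k) * indicator (ball 0 (r k)) z \<partial>(lborel :: (real ^ 'n) measure))"
    by (rule nn_integral_suminf) measurable
  also have "\<dots> = (\<Sum>k. ennreal (omega * (a k * r k powr n)))"
  proof (rule suminf_cong)
    fix k
    have "(\<integral>\<^sup>+ z. ennreal (a k) * indicator (ball 0 (r k)) z \<partial>(lborel :: (real ^ 'n) measure))
        = ennreal (a k) * emeasure lborel (ball (0 :: real ^ 'n) (r k))"
      by (rule nn_integral_cmult_indicator) simp
    also have "emeasure lborel (ball (0 :: real ^ 'n) (r k)) = ennreal (omega * r k powr n)"
      using ball_facts[OF r[of k], of 0] measure_ball[OF r[of k], of 0]
      by (simp add: emeasure_eq_ennreal_measure)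
    finally show "(\<integral>\<^sup>+ z. ennreal (a k) * indicator (ball 0 (r k)) z \<partial>(lborel :: (real ^ 'n) measure))
        = ennreal (omega * (a k * r k powr n))"
      using a[of k] omega_pos by (simp add: ennreal_mult'[symmetric] mult_ac)
  qed
  also have "\<dots> < \<infinity>"
    using a omega_pos summable_mult[OF sum, of omega]
    by (subst suminf_ennreal2) (auto simp: mult_nonneg_nonneg)
  finally show "(\<integral>\<^sup>+ z. ennreal (norm (g z)) \<partial>lborel) < \<infinity>" .
qed measurable

lemma summable_two_powr:
  fixes c :: real
  assumes "c < 0"
  shows "summable (\<lambda>k. 2 powr (c * real k))"
proof -
  have "norm (2 powr c) < 1" using powr_less_mono[of c 0 2] assms by simp
  then have "summable (\<lambda>k. (2 powr c) ^ k)" by (rule summable_geometric)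
  then show ?thesis by (simp add: powr_power mult.commute)
qed

text \<open>A bounded Lipschitz function satisfies \<open>\<bar>v x - v y\<bar> powr p \<le> C * min
  1 (norm (x - y) powr p)\<close>, so \<open>C * kernel (x - y)\<close> majorises its Gagliardo
  integrand.\<close>

definition kernel :: "real ^ 'n \<Rightarrow> real" where
  "kernel z = min 1 (norm z powr p) / norm z powr (n + s * p)"

lemma kernel_nonneg: "0 \<le> kernel z" by (simp add: kernel_def)

lemma borel_measurable_kernel [measurable]: "kernel \<in> borel_measurable borel"
  unfolding kernel_def[abs_def] by measurable

lemma kernel_minus: "kernel (- z) = kernel z" by (simp add: kernel_def)

text \<open>Near 0 the kernel is of order \<open>p - n - s * p\<close>, which is integrable because
  \<open>s < 1\<close>; at infinity it is of order \<open>- n - s * p\<close>, which is integrable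
  because \<open>0 < s\<close>. Each region is summed over dyadic shells.\<close>

lemma integrable_kernel:
  assumes s1: "s < 1"
  shows "integrable lborel kernel"
proof -
  \<comment> \<open>Truncating at 0 keeps \<open>norm z powr (- b)\<close> nonincreasing in
    \<open>norm z\<close>, so that one bound per shell works for either sign of
    \<open>n + s * p - p\<close>.\<close>
  define b where "b = max 0 (n + s * p - p)"
  have b: "0 \<le> b" "b < n" "n + s * p - p \<le> b"
    using n_pos s1 p_gt_1 by (auto simp: b_def)
  define g1 where "g1 z = (if norm z < 1 then kernel z else 0)" for z
  define g2 where "g2 z = (if norm z < 1 then 0 else kernel z)" for z
  have [measurable]: "g1 \<in> borel_measurable borel" "g2 \<in> borel_measurable borel"
    by (auto simp: g1_def[abs_def] g2_def[abs_def])
  have "integrable lborel g1"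
  \<comment> \<open>The shells are \<open>2 powr (- k - 1) < norm z \<le> 2 powr (- k)\<close>. The
    outer bound is attained, so the radius is doubled to contain the shell in an open ball; the
    inner bound gives the exponent \<open>k + 1\<close> in the height.\<close>
  proof (rule integrable_of_ball_cover[where r = "\<lambda>k. 2 powr (1 - real k)" and a = "\<lambda>k. 2 powr (b * (real k + 1))"])
    fix z assume "g1 z \<noteq> 0"
    then have z: "norm z < 1" "z \<noteq> 0" by (auto simp: g1_def kernel_def split: if_splits)
    have "1 \<le> 1 / norm z" using z by (simp add: field_simps)
    then obtain k :: nat where k: "2 powr k \<le> 1 / norm z" "1 / norm z < 2 powr (k + 1)"
      by (rule ex_dyadic_ge_1)
    have le: "norm z \<le> 2 powr (- real k)" using k z by (simp add: powr_minus field_simps)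
    also have "\<dots> < 2 powr (1 - real k)" by simp
    finally have 1: "norm z < 2 powr (1 - real k)" .
    have "g1 z \<le> norm z powr (- b)"
    proof -
      have "g1 z \<le> norm z powr p / norm z powr (n + s * p)"
        using z by (auto simp: g1_def kernel_def intro: divide_right_mono)
      also have "\<dots> = norm z powr (p - (n + s * p))" using z by (simp add: powr_diff)
      also have "\<dots> \<le> norm z powr (- b)" using z b by (intro powr_mono') auto
      finally show ?thesis .
    qed
    also have "\<dots> = (1 / norm z) powr b" using z by (simp add: powr_divide powr_minus_divide)
    also have "\<dots> \<le> (2 powr (k + 1)) powr b" using k z b by (intro powr_mono2) auto
    also have "\<dots> = 2 powr (b * (real k + 1))" by (simp add: powr_powr mult.commute add.commute)
    finally show "\<exists>k. norm z < 2 powr (1 - real k) \<and> g1 z \<le> 2 powr (b * (real k + 1))" using 1 by blast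
  next
    have "2 powr (b * (real k + 1)) * (2 powr (1 - real k)) powr n = 2 powr (b + n) * 2 powr ((b - n) * real k)" for k
      by (simp add: powr_powr algebra_simps flip: powr_add)
    then show "summable (\<lambda>k. 2 powr (b * (real k + 1)) * (2 powr (1 - real k)) powr n)"
      using summable_two_powr[of "b - n"] b by simp
  qed (auto simp: g1_def kernel_nonneg)
  moreover have "integrable lborel g2"
  proof (rule integrable_of_ball_cover[where r = "\<lambda>k. 2 powr (real k + 1)" and a = "\<lambda>k. 2 powr (- (n + s * p) * real k)"])
    fix z assume "g2 z \<noteq> 0"
    then have z: "1 \<le> norm z" by (auto simp: g2_def split: if_splits)
    then obtain k :: nat where k: "2 powr k \<le> norm z" "norm z < 2 powr (k + 1)"
      by (rule ex_dyadic_ge_1)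
    have np: "0 \<le> n + s * p" using n_pos s_pos p_gt_1 by simp
    have "g2 z \<le> 1 / norm z powr (n + s * p)"
      using z by (auto simp: g2_def kernel_def intro: divide_right_mono)
    also have "\<dots> \<le> 1 / (2 powr k) powr (n + s * p)"
      using k z np by (intro divide_left_mono powr_mono2 mult_pos_pos) auto
    also have "\<dots> = 2 powr (- (n + s * p) * real k)"
      by (simp add: powr_powr powr_minus_divide[symmetric] algebra_simps)
    finally show "\<exists>k. norm z < 2 powr (real k + 1) \<and> g2 z \<le> 2 powr (- (n + s * p) * real k)"
      using k by (auto simp: add.commute)
  next
    have "2 powr (- (n + s * p) * real k) * (2 powr (real k + 1)) powr n = 2 powr n * 2 powr (- (s * p) * real k)" for k
      by (simp add: powr_powr algebra_simps flip: powr_add)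
    then show "summable (\<lambda>k. 2 powr (- (n + s * p) * real k) * (2 powr (real k + 1)) powr n)"
      using summable_two_powr[of "- (s * p)"] s_pos p_gt_1 by simp
  qed (auto simp: g2_def kernel_nonneg)
  moreover have "kernel = (\<lambda>z. g1 z + g2 z)" by (auto simp: g1_def g2_def fun_eq_iff)
  ultimately show ?thesis by simp
qed

text \<open>The integrand vanishes unless \<open>x\<close> or \<open>y\<close> lies in
  \<open>ball 0 R\<close>. It is therefore dominated by \<open>kernel (x - y)\<close> restricted to
  one variable in that ball plus the same with the roles exchanged, and Fubini reduces both to
  \<open>integrable_kernel\<close>.\<close>

lemma lipschitz_in_borel_Dsp:
  fixes v :: "real ^ 'n \<Rightarrow> real"
  assumes s1: "s < 1" and lip: "\<And>x y. \<bar>v x - v y\<bar> \<le> L * norm (x - y)"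
    and bd: "\<And>x. \<bar>v x\<bar> \<le> B" and supp: "\<And>x. R \<le> norm x \<Longrightarrow> v x = 0"
  shows "v \<in> borel_Dsp"
proof -
  have B: "0 \<le> B" using bd[of 0] abs_ge_zero[of "v 0"] by linarith
  have "continuous_on UNIV v"
    unfolding continuous_on_iff
  proof (intro ballI allI impI)
    fix x :: "real ^ 'n" and e :: real assume e: "0 < e"
    have "dist (v y) (v x) < e" if d: "dist y x < e / (\<bar>L\<bar> + 1)" for y
    proof -
      have "dist (v y) (v x) \<le> L * norm (y - x)" using lip by (simp add: dist_real_def)
      also have "\<dots> \<le> (\<bar>L\<bar> + 1) * norm (y - x)" by (intro mult_right_mono) auto
      also have "\<dots> < e" using d by (simp add: dist_norm pos_less_divide_eq mult.commute)
      finally show ?thesis .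
    qed
    then show "\<exists>d>0. \<forall>y\<in>UNIV. dist y x < d \<longrightarrow> dist (v y) (v x) < e"
      using e by (intro exI[of _ "e / (\<bar>L\<bar> + 1)"]) auto
  qed
  then have [measurable]: "v \<in> borel_measurable borel" by (rule borel_measurable_continuous_onI)
  have ball[measurable]: "ball (0 :: real ^ 'n) R \<in> sets borel" by simp
  have emb: "emeasure lborel (ball (0 :: real ^ 'n) R) < \<infinity>"
    using emeasure_lborel_ball_finite[of 0 R] by simp
  have "integrable lborel (\<lambda>x. \<bar>v x\<bar> powr q)"
  proof (rule Bochner_Integration.integrable_bound)
    show "integrable lborel (\<lambda>x. B powr q * indicator (ball (0 :: real ^ 'n) R) x)"
      using emb by (intro integrable_mult_right integrable_real_indicator) auto
    have "\<bar>v x\<bar> powr q \<le> B powr q * indicator (ball 0 R) x" for x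
      using bd[of x] supp[of x] q_gt_1 by (auto simp: indicator_def intro: powr_mono2)
    then show "AE x in lborel. norm (\<bar>v x\<bar> powr q) \<le> norm (B powr q * indicator (ball 0 R) x)"
      by (intro AE_I2) simp
  qed measurable
  moreover have "integrable lborel (\<lambda>z. \<bar>diff_quot v z\<bar> powr p)"
  proof -
    define C where "C = max \<bar>L\<bar> (2 * B) powr p"
    have diff: "\<bar>v x - v y\<bar> powr p \<le> C * min 1 (norm (x - y) powr p)" for x y
    proof -
      have "\<bar>v x - v y\<bar> powr p \<le> max \<bar>L\<bar> (2 * B) powr p"
        using bd[of x] bd[of y] p_gt_1 by (intro powr_mono2) (auto simp: le_max_iff_disj)
      moreover have "\<bar>v x - v y\<bar> \<le> max \<bar>L\<bar> (2 * B) * norm (x - y)"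
        by (rule order_trans[OF lip]) (intro mult_right_mono, auto)
      then have "\<bar>v x - v y\<bar> powr p \<le> (max \<bar>L\<bar> (2 * B) * norm (x - y)) powr p"
        using p_gt_1 by (intro powr_mono2) auto
      ultimately show ?thesis by (simp add: C_def powr_mult min_def)
    qed
    define G where "G = (\<lambda>(x, y). indicator (ball 0 R) x * kernel (x - y))"
    have [measurable]: "G \<in> borel_measurable (lborel \<Otimes>\<^sub>M lborel)"
      unfolding G_def by measurable
    have K: "integrable lborel (\<lambda>y. kernel (x - y))" "(LINT y|lborel. kernel (x - y)) = (LINT y|lborel. kernel y)" for x
    proof -
      have e: "kernel (x - y) = kernel (- x + 1 *\<^sub>R y)" for y
        using kernel_minus[of "x - y"] by simp
      show "integrable lborel (\<lambda>y. kernel (x - y))"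
        unfolding e by (subst lborel_integrable_affine_iff[where f = kernel]) (auto simp: integrable_kernel s1)
      show "(LINT y|lborel. kernel (x - y)) = (LINT y|lborel. kernel y)"
        unfolding e by (subst lborel_integral_affine[where f = kernel]) auto
    qed
    have iG: "integrable (lborel \<Otimes>\<^sub>M lborel) G"
    proof (rule lborel_pair.Fubini_integrable)
      have "norm (G (x, y)) = indicator (ball 0 R) x * kernel (x - y)" for x y
        by (simp add: G_def kernel_nonneg abs_mult)
      then show "integrable lborel (\<lambda>x. LINT y|lborel. norm (G (x, y)))"
        using emb by (simp add: K)
      show "AE x in lborel. integrable lborel (\<lambda>y. G (x, y))"
        by (simp add: G_def K)
    qed measurable
    have iG': "integrable (lborel \<Otimes>\<^sub>M lborel) (\<lambda>(x, y). G (y, x))"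
      by (rule lborel_pair.integrable_product_swap[OF iG])
    have "integrable lborel (\<lambda>z. C * (G z + G (snd z, fst z)))"
      using iG iG' unfolding lborel_prod case_prod_beta
      by (intro integrable_mult_right Bochner_Integration.integrable_add)
    then show ?thesis
    proof (rule Bochner_Integration.integrable_bound)
      have "\<bar>diff_quot v z\<bar> powr p \<le> C * (G z + G (snd z, fst z))" for z
      proof -
        obtain x y where z: "z = (x, y)" by fastforce
        have ky: "kernel (y - x) = kernel (x - y)" using kernel_minus[of "x - y"] by simp
        have k: "\<bar>v x - v y\<bar> powr p / norm (x - y) powr (n + s * p) \<le> C * kernel (x - y)"
          using divide_right_mono[OF diff[of x y], of "norm (x - y) powr (n + s * p)"] by (simp add: kernel_def)
        have "0 \<le> C * kernel (x - y)" by (simp add: C_def kernel_nonneg)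
        then show ?thesis
          using k supp[of x] supp[of y]
          by (auto simp: z diff_quot_powr gagliardo_integrand_def G_def ky indicator_def simp flip: n_eq)
      qed
      then show "AE z in lborel. norm (\<bar>diff_quot v z\<bar> powr p) \<le> norm (C * (G z + G (snd z, fst z)))"
        by (intro AE_I2) (simp, smt (verit))
    qed measurable
  qed
  ultimately show ?thesis by (simp add: borel_Dsp_def)
qed

text \<open>The partial derivatives are continuous and vanish off the compact support, hence are
  bounded; the mean value inequality then makes \<open>v\<close> Lipschitz.\<close>

lemma test_functions_in_borel_Dsp:
  fixes v :: "real ^ 'n \<Rightarrow> real"
  assumes s1: "s < 1" and v: "v \<in> test_functions"
  shows "v \<in> borel_Dsp"
proof -
  let ?K = "closure {x. v x \<noteq> 0}"
  have K: "compact ?K" and C1: "Ck (Suc 0) v"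
    using v unfolding test_functions_def by blast+
  have out: "v x = 0" if "x \<notin> ?K" for x
    using that closure_subset[of "{x. v x \<noteq> 0}"] by auto
  have diff: "v differentiable (at x)" for x using C1 by simp
  have "continuous_on UNIV v"
    using diff by (simp add: continuous_at_imp_continuous_on differentiable_imp_continuous_within)
  define P where "P i x = frechet_derivative v (at x) (axis i 1)" for i x
  have Pc: "continuous_on UNIV (P i)" for i using C1 by (simp add: P_def[abs_def])
  have P0: "P i x = 0" if "x \<notin> ?K" for i x
  proof -
    have "(v has_derivative (\<lambda>_. 0)) (at x)"
    proof (rule has_derivative_transform_within_open)
      show "((\<lambda>_. 0) has_derivative (\<lambda>_. 0)) (at x)" by (rule has_derivative_const)
      show "open (- ?K)" by (rule open_Compl) (rule closed_closure)
      show "x \<in> - ?K" using that by blast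
      show "0 = v y" if "y \<in> - ?K" for y using that out by (metis ComplD)
    qed
    then have "frechet_derivative v (at x) = (\<lambda>_. 0)" by (rule frechet_derivative_at[symmetric])
    then show ?thesis by (simp add: P_def)
  qed
  have bounded_supp: "\<exists>B\<ge>0. \<forall>x. \<bar>f x\<bar> \<le> B" if f: "continuous_on UNIV f" "\<And>x. x \<notin> ?K \<Longrightarrow> f x = 0"
    for f :: "real ^ 'n \<Rightarrow> real"
  proof -
    have "bounded (f ` ?K)"
      using K f by (intro compact_imp_bounded compact_continuous_image continuous_on_subset[OF f(1)]) auto
    then obtain B where B: "\<And>x. x \<in> ?K \<Longrightarrow> \<bar>f x\<bar> \<le> B" by (auto simp: bounded_iff)
    have "\<bar>f x\<bar> \<le> max 0 B" for x using B[of x] f(2)[of x] by (cases "x \<in> ?K") auto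
    then show ?thesis by (intro exI[of _ "max 0 B"]) auto
  qed
  obtain B where B: "\<And>x. \<bar>v x\<bar> \<le> B" using bounded_supp[of v] \<open>continuous_on UNIV v\<close> out by blast
  have "\<forall>i. \<exists>B\<ge>0. \<forall>x. \<bar>P i x\<bar> \<le> B" using bounded_supp Pc P0 by blast
  then obtain G where G: "\<And>i. 0 \<le> G i" "\<And>i x. \<bar>P i x\<bar> \<le> G i" by metis
  define L where "L = (\<Sum>i\<in>UNIV. G i)"
  have lip: "\<bar>v x - v y\<bar> \<le> L * norm (x - y)" for x y
  proof -
    have "norm (v x - v y) \<le> L * norm (x - y)"
    proof (rule differentiable_bound[of UNIV v "\<lambda>x. frechet_derivative v (at x)"])
      show "(v has_derivative frechet_derivative v (at x)) (at x)" for x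
        using diff by (simp add: frechet_derivative_works)
      then have lin: "linear (frechet_derivative v (at x))" for x by (rule has_derivative_linear)
      show "onorm (frechet_derivative v (at x)) \<le> L" for x
      proof (rule onorm_le)
        fix h :: "real ^ 'n"
        have "frechet_derivative v (at x) h = frechet_derivative v (at x) (\<Sum>i\<in>UNIV. h $ i *\<^sub>R axis i 1)"
          using basis_expansion[of h] by (simp add: scalar_mult_eq_scaleR)
        also have "\<dots> = (\<Sum>i\<in>UNIV. h $ i * P i x)"
          using lin by (simp add: linear_sum linear_scale P_def)
        finally have "norm (frechet_derivative v (at x) h) \<le> (\<Sum>i\<in>UNIV. \<bar>h $ i * P i x\<bar>)"
          by (simp add: sum_abs)
        also have "\<dots> \<le> (\<Sum>i\<in>UNIV. norm h * G i)"
          using G by (intro sum_mono) (auto simp: abs_mult component_le_norm_cart intro: mult_mono)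
        also have "\<dots> = L * norm h" by (simp add: L_def sum_distrib_left mult.commute)
        finally show "norm (frechet_derivative v (at x) h) \<le> L * norm h" .
      qed
    qed auto
    then show ?thesis by simp
  qed
  obtain R where R: "?K \<subseteq> ball 0 R"
    using compact_imp_bounded[OF K] bounded_subset_ballD[of ?K 0] by blast
  have "v x = 0" if "R \<le> norm x" for x
  proof (rule out)
    show "x \<notin> ?K" using R that by (auto simp: subset_iff)
  qed
  then show ?thesis using lipschitz_in_borel_Dsp[OF s1 lip B] by blast
qed

text \<open>A normalised cone; it makes the constraint set of the minimisation nonempty.\<close>

lemma ex_mass_eq_1:
  assumes s1: "s < 1"
  obtains v where "v \<in> borel_Dsp" "mass v = 1"
proof -
  define v :: "real ^ 'n \<Rightarrow> real" where "v x = max 0 (1 - norm x)" for x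
  have lip: "\<bar>v x - v y\<bar> \<le> 1 * norm (x - y)" for x y
    using norm_triangle_ineq2[of x y] norm_triangle_ineq2[of y x]
    by (auto simp: v_def max_def norm_minus_commute)
  have v: "v \<in> borel_Dsp"
    by (rule lipschitz_in_borel_Dsp[OF s1 lip, where B = 1 and R = 1]) (auto simp: v_def)
  have "mass v \<noteq> 0"
  proof
    assume "mass v = 0"
    then have "AE x in lborel. \<bar>v x\<bar> powr q = 0"
      unfolding mass_def by (subst (asm) integral_nonneg_eq_0_iff_AE[OF borel_Dsp_mass[OF v]]) auto
    then have "AE x in lborel. x \<notin> ball (0 :: real ^ 'n) 1"
      by eventually_elim (auto simp: v_def)
    then have "emeasure lborel {x :: real ^ 'n. norm x < 1} = 0"
      by (subst (asm) AE_iff_measurable[OF _ refl]) (auto simp: ball_def)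
    then show False using ball_facts[of 1 0] by (simp add: measure_def ball_def)
  qed
  then have m: "0 < mass v" using mass_nonneg[of v] by simp
  have "mass (\<lambda>x. mass v powr (- 1 / q) * v x) = 1"
    unfolding mass_scale using m q_gt_1 by (simp add: powr_powr powr_neg_one)
  then show ?thesis using that borel_Dsp_scale[OF v] by blast
qed

end

section \<open>Compactness\<close>

locale weighted_fractional_sobolev = fractional_sobolev s p n q dims
  for s p n q :: real and dims :: "'n::finite itself" +
  fixes h :: "real ^ 'n \<Rightarrow> real" and x\<^sub>0 :: "real ^ 'n"
  assumes s_less_1: "s < 1"
    and h_measurable: "h \<in> borel_measurable lebesgue"
    and h_nonneg: "AE x in lebesgue. 0 \<le> h x"
    and compact_embedding: "compactly_embedded (Dsp s p) (gagliardo_seminorm s p)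
           (Lp_space (weighted_measure h) p) (Lp_norm (weighted_measure h) p)"
    and h_cont: "isCont h x\<^sub>0" and h_pos: "h x\<^sub>0 > 0"
begin

abbreviation W :: "(real ^ 'n) measure" where "W \<equiv> weighted_measure h"

definition potential :: "(real ^ 'n \<Rightarrow> real) \<Rightarrow> real" where
  "potential u = (LINT x|W. \<bar>u x\<bar> powr p)"

lemma measurable_W: "u \<in> borel_measurable borel \<Longrightarrow> u \<in> borel_measurable W"
  by (simp add: measurable_completion)

lemma integral_W:
  assumes "f \<in> borel_measurable lebesgue"
  shows "(LINT x|W. f x) = (LINT x|lebesgue. h x * f x)"
  using integral_density[OF assms h_measurable h_nonneg] by simp

lemma integrable_W:
  fixes f :: "real ^ 'n \<Rightarrow> real"
  assumes "f \<in> borel_measurable lebesgue"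
  shows "integrable W f \<longleftrightarrow> integrable lebesgue (\<lambda>x. h x * f x)"
  using integrable_density[OF assms h_measurable h_nonneg] by simp

lemma potential_eq:
  assumes "u \<in> borel_measurable borel"
  shows "potential u = (LINT x|lebesgue. h x * \<bar>u x\<bar> powr p)"
  unfolding potential_def
  by (intro integral_W measurable_completion) (use assms in measurable)

lemma potential_nonneg: "0 \<le> potential u"
  unfolding potential_def by (intro integral_nonneg_AE AE_I2) auto

lemma integrable_potential:
  assumes "u \<in> borel_Dsp"
  shows "integrable W (\<lambda>x. \<bar>u x\<bar> powr p)"
proof -
  have "u \<in> Lp_space W p"
    using assms borel_Dsp_subset compact_embedding[unfolded compactly_embedded_def, THEN conjunct1] by blast
  then show ?thesis by (simp add: Lp_space_def)
qed

lemma potential_scale: "potential (\<lambda>x. c * u x) = \<bar>c\<bar> powr p * potential u"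
  by (simp add: potential_def abs_mult powr_mult)

lemma AE_W:
  assumes "AE x in lborel. P x"
  shows "AE x in W. P x"
proof -
  have "AE x in lebesgue. P x" using assms by (rule AE_completion)
  then have "AE x in lebesgue. 0 < ennreal (h x) \<longrightarrow> P x" by eventually_elim simp
  then show ?thesis using h_measurable by (subst AE_density) auto
qed

lemma h_lower_bound:
  obtains rho c where "0 < rho" "0 < c" "\<And>x. x \<in> ball x\<^sub>0 rho \<Longrightarrow> c \<le> h x"
proof -
  obtain d where d: "0 < d" "\<And>x. dist x x\<^sub>0 < d \<Longrightarrow> dist (h x) (h x\<^sub>0) < h x\<^sub>0 / 2"
    using h_cont h_pos unfolding continuous_at_eps_delta
    by (elim allE[of _ "h x\<^sub>0 / 2"]) auto
  show ?thesis
  proof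
    show "0 < d" "0 < h x\<^sub>0 / 2" using d h_pos by auto
    fix x assume "x \<in> ball x\<^sub>0 d"
    then have "dist (h x) (h x\<^sub>0) < h x\<^sub>0 / 2" by (intro d) (simp add: dist_commute)
    then show "h x\<^sub>0 / 2 \<le> h x" by (simp add: dist_real_def abs_if split: if_splits)
  qed
qed

text \<open>Both kinds of convergence are kept: the integral one gives convergence of potentials,
  the pointwise one later identifies \<open>w\<close> with the Lebesgue limit. By itself the
  \<open>W\<close>-almost everywhere statement says nothing where \<open>h\<close> vanishes.\<close>

lemma weighted_subsequence:
  fixes u :: "nat \<Rightarrow> real ^ 'n \<Rightarrow> real"
  assumes u: "\<And>k. u k \<in> borel_Dsp" and E: "\<And>k. energy (u k) \<le> C"
  obtains r w where "strict_mono r" "w \<in> borel_measurable W" "integrable W (\<lambda>x. \<bar>w x\<bar> powr p)"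
    "(\<lambda>k. LINT x|W. \<bar>u (r k) x - w x\<bar> powr p) \<longlonglongrightarrow> 0"
    "AE x in W. (\<lambda>k. u (r k) x) \<longlonglongrightarrow> w x"
proof -
  have "gagliardo_seminorm s p (u k) \<le> C powr (1 / p)" for k
    unfolding gagliardo_seminorm_def using E energy_nonneg p_gt_1 by (intro powr_mono2) auto
  then have "bounded (range (\<lambda>k. gagliardo_seminorm s p (u k)))"
    by (intro boundedI[where B = "C powr (1 / p)"]) (auto simp: gagliardo_seminorm_def)
  moreover have "\<forall>k. u k \<in> Dsp s p" using u borel_Dsp_subset by blast
  ultimately have "\<exists>r w. strict_mono r \<and> w \<in> Lp_space W p \<and>
      (\<lambda>k. Lp_norm W p (\<lambda>x. u (r k) x - w x)) \<longlonglongrightarrow> 0"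
    by (intro compact_embedding[unfolded compactly_embedded_def, THEN conjunct2, THEN conjunct2,
          THEN spec, THEN mp] conjI)
  then obtain r w where r: "strict_mono r" and w: "w \<in> Lp_space W p"
    and lim: "(\<lambda>k. Lp_norm W p (\<lambda>x. u (r k) x - w x)) \<longlonglongrightarrow> 0"
    by (elim exE conjE)
  have wm: "w \<in> borel_measurable W" and wi: "integrable W (\<lambda>x. \<bar>w x\<bar> powr p)"
    using w by (simp_all add: Lp_space_def)
  have um: "u k \<in> borel_measurable W" for k using borel_DspD[OF u] by (rule measurable_W)
  have int: "integrable W (\<lambda>x. \<bar>u k x - w x\<bar> powr p)" for k
    using p_gt_1 by (intro integrable_powr_diff um wm wi integrable_potential u) auto
  have nn: "0 \<le> (LINT x|W. \<bar>u k x - w x\<bar> powr p)" for k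
    by (intro integral_nonneg_AE AE_I2) auto
  have eq: "Lp_norm W p (\<lambda>x. u k x - w x) powr p = (LINT x|W. \<bar>u k x - w x\<bar> powr p)" for k
    using nn[of k] p_gt_1 by (simp add: Lp_norm_def powr_powr)
  have "(\<lambda>k. Lp_norm W p (\<lambda>x. u (r k) x - w x) powr p) \<longlonglongrightarrow> 0 powr p"
    using p_gt_1 by (intro tendsto_powr2 lim tendsto_const) (auto simp: Lp_norm_def)
  then have lim0: "(\<lambda>k. LINT x|W. \<bar>u (r k) x - w x\<bar> powr p) \<longlonglongrightarrow> 0"
    unfolding eq by simp
  then have "(\<lambda>k. LINT x|W. norm (\<bar>u (r k) x - w x\<bar> powr p)) \<longlonglongrightarrow> 0" by simp
  with int obtain r' where r': "strict_mono r'"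
    "AE x in W. (\<lambda>k. \<bar>u (r (r' k)) x - w x\<bar> powr p) \<longlonglongrightarrow> 0"
    using tendsto_L1_AE_subseq[of W "\<lambda>k x. \<bar>u (r k) x - w x\<bar> powr p"] by auto
  show ?thesis
  proof (rule that[of "r \<circ> r'" w])
    show "strict_mono (r \<circ> r')" by (intro strict_mono_o r r')
    show "(\<lambda>k. LINT x|W. \<bar>u ((r \<circ> r') k) x - w x\<bar> powr p) \<longlonglongrightarrow> 0"
      using LIMSEQ_subseq_LIMSEQ[OF lim0 r'(1)] by (simp add: comp_def)
    show "AE x in W. (\<lambda>k. u ((r \<circ> r') k) x) \<longlonglongrightarrow> w x"
      using r'(2)
    proof eventually_elim
      case (elim x)
      have "(\<lambda>k. (\<bar>u (r (r' k)) x - w x\<bar> powr p) powr (1 / p)) \<longlonglongrightarrow> 0 powr (1 / p)"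
        using p_gt_1 by (intro tendsto_powr2 elim tendsto_const) auto
      then have "(\<lambda>k. \<bar>u (r (r' k)) x - w x\<bar>) \<longlonglongrightarrow> 0"
        using p_gt_1 by (simp add: powr_powr)
      then show ?case by (simp add: LIM_zero_iff tendsto_rabs_zero_iff comp_def)
    qed
  qed (use wm wi in auto)
qed

text \<open>The weight only controls a ball around \<open>x\<^sub>0\<close>; scaling transports this to every ball.\<close>

lemma local_convergent_subsequence:
  assumes u: "\<And>k. u k \<in> borel_Dsp" and E: "\<And>k. energy (u k) \<le> C" and R: "0 < R"
  obtains r :: "nat \<Rightarrow> nat" where "strict_mono r"
    "AE x in lborel. x \<in> ball 0 R \<longrightarrow> convergent (\<lambda>k. u (r k) x)"
proof -
  obtain rho c where rho: "0 < rho" "0 < c" and hc: "\<And>x. x \<in> ball x\<^sub>0 rho \<Longrightarrow> c \<le> h x"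
    using h_lower_bound by blast
  define a where "a = R / rho"
  have a: "0 < a" using R rho by (simp add: a_def)
  \<comment> \<open>The substitution carries \<open>ball x\<^sub>0 rho\<close> onto
    \<open>ball 0 R\<close>, so convergence of \<open>f\<close> on the first ball is convergence of
    \<open>u\<close> on the second.\<close>
  define f where "f k x = u k (- (a *\<^sub>R x\<^sub>0) + a *\<^sub>R x)" for k x
  have f: "f k \<in> borel_Dsp" for k
    unfolding f_def by (intro borel_Dsp_affine u a borel_DspD)
  have Ef: "energy (f k) \<le> a powr (s * p - n) * C" for k
    unfolding f_def using E[of k] by (subst energy_affine) (auto intro: u a borel_DspD mult_left_mono)
  obtain r w where r: "strict_mono r" "AE x in W. (\<lambda>k. f (r k) x) \<longlonglongrightarrow> w x"
    by (rule weighted_subsequence[of f, OF f Ef])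
  have "AE x in lebesgue. 0 < ennreal (h x) \<longrightarrow> (\<lambda>k. f (r k) x) \<longlonglongrightarrow> w x"
    using r(2) h_measurable by (subst (asm) AE_density) auto
  \<comment> \<open>On this ball \<open>h\<close> is at least \<open>c\<close>, so null sets of
    \<open>W\<close> are Lebesgue null sets there.\<close>
  then have "AE x in lebesgue. x \<in> ball x\<^sub>0 rho \<longrightarrow> convergent (\<lambda>k. f (r k) x)"
  proof eventually_elim
    case (elim x)
    show ?case
    proof
      assume "x \<in> ball x\<^sub>0 rho"
      then have "0 < h x" using hc rho by fastforce
      then show "convergent (\<lambda>k. f (r k) x)" using elim by (auto simp: convergent_def)
    qed
  qed
  then have "AE x in lborel. x \<in> ball x\<^sub>0 rho \<longrightarrow> convergent (\<lambda>k. f (r k) x)"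
    by (simp add: AE_completion_iff)
  from AE_lborel_affine[OF this, of "1 / a" x\<^sub>0] a
  have "AE x in lborel. x \<in> ball 0 R \<longrightarrow> convergent (\<lambda>k. u (r k) x)"
  proof (simp, elim eventually_mono, intro impI)
    fix x assume *: "dist x\<^sub>0 (x\<^sub>0 + (1 / a) *\<^sub>R x) < rho \<longrightarrow>
        convergent (\<lambda>k. f (r k) (x\<^sub>0 + (1 / a) *\<^sub>R x))" and x: "norm x < R"
    have "dist x\<^sub>0 (x\<^sub>0 + (1 / a) *\<^sub>R x) = norm x / a" using a by (simp add: dist_norm)
    also have "\<dots> < rho" using x a rho by (simp add: a_def pos_divide_less_eq field_simps)
    finally have "convergent (\<lambda>k. f (r k) (x\<^sub>0 + (1 / a) *\<^sub>R x))" using * by blast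
    then show "convergent (\<lambda>k. u (r k) x)"
      using a by (simp add: f_def scaleR_add_right)
  qed
  then show ?thesis by (rule that[OF r(1)])
qed

text \<open>Diagonal extraction over the balls of radius \<open>N + 1\<close>, which exhaust the
  space.\<close>

lemma convergent_subsequence:
  assumes u: "\<And>k. u k \<in> borel_Dsp" and E: "\<And>k. energy (u k) \<le> C"
  obtains r :: "nat \<Rightarrow> nat" where "strict_mono r" "AE x in lborel. convergent (\<lambda>k. u (r k) x)"
proof -
  define P where "P N t \<longleftrightarrow> (AE x in lborel. x \<in> ball 0 (real (Suc N)) \<longrightarrow> convergent (\<lambda>k. u (t k) x))"
    for N :: nat and t :: "nat \<Rightarrow> nat"
  interpret subseqs P
  proof
    fix N and t :: "nat \<Rightarrow> nat"
    obtain r :: "nat \<Rightarrow> nat" where "strict_mono r"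
      "AE x in lborel. x \<in> ball 0 (real (Suc N)) \<longrightarrow> convergent (\<lambda>k. u (t (r k)) x)"
      by (rule local_convergent_subsequence[of "\<lambda>k. u (t k)" C "real (Suc N)", OF u E]) simp
    then show "\<exists>r'. strict_mono r' \<and> P N (t \<circ> r')" by (auto simp: P_def)
  qed
  have stable: "P N (t \<circ> r)" if "strict_mono r" "P N t" for r t :: "nat \<Rightarrow> nat" and N
    using that(2) unfolding P_def
  proof eventually_elim
    case (elim x)
    then show ?case
      using convergent_subseq_convergent[OF _ that(1), of "\<lambda>k. u (t k) x"] by (auto simp: comp_def)
  qed
  \<comment> \<open>The diagonal sequence is a subsequence of the \<open>N\<close>-th one after its
    first \<open>N + 1\<close> terms; as convergence ignores initial segments, the shift is undone
    below.\<close>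
  have "P N (diagseq \<circ> (+) (Suc N))" for N
    by (rule diagseq_holds) (rule stable)
  then have "AE x in lborel. \<forall>N. x \<in> ball 0 (real (Suc N)) \<longrightarrow> convergent (\<lambda>k. u (diagseq (Suc N + k)) x)"
    unfolding P_def by (subst AE_all_countable) (simp add: comp_def)
  then have "AE x in lborel. convergent (\<lambda>k. u (diagseq k) x)"
  proof eventually_elim
    case (elim x)
    obtain N where "norm x < real N" using reals_Archimedean2 by blast
    then have "convergent (\<lambda>k. u (diagseq (Suc N + k)) x)" using elim by auto
    then show ?case
      using convergent_ignore_initial_segment[of "\<lambda>k. u (diagseq k) x" "Suc N"] by (simp add: add.commute)
  qed
  then show ?thesis by (rule that[OF subseq_diagseq])
qed

text \<open>The subsequence has two limits: \<open>w\<close> with respect to \<open>W\<close>, from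
  the embedding, and \<open>g\<close> almost everywhere for Lebesgue measure, from the diagonal
  argument. They agree \<open>W\<close>-almost everywhere, so the potential converges to that of
  \<open>g\<close>; Fatou puts \<open>g\<close> into \<open>borel_Dsp\<close>.\<close>

lemma compactness:
  fixes u :: "nat \<Rightarrow> real ^ 'n \<Rightarrow> real"
  assumes u: "\<And>k. u k \<in> borel_Dsp" and E: "\<And>k. energy (u k) \<le> C" and M: "\<And>k. mass (u k) \<le> C'"
  obtains r g where "strict_mono r" "g \<in> borel_Dsp" "AE x in lborel. (\<lambda>k. u (r k) x) \<longlonglongrightarrow> g x"
    "(\<lambda>k. potential (u (r k))) \<longlonglongrightarrow> potential g"
proof -
  obtain r1 w where r1: "strict_mono r1" "w \<in> borel_measurable W" "integrable W (\<lambda>x. \<bar>w x\<bar> powr p)"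
    "(\<lambda>k. LINT x|W. \<bar>u (r1 k) x - w x\<bar> powr p) \<longlonglongrightarrow> 0"
    "AE x in W. (\<lambda>k. u (r1 k) x) \<longlonglongrightarrow> w x"
    by (rule weighted_subsequence[of u, OF u E])
  obtain r2 where r2: "strict_mono r2" "AE x in lborel. convergent (\<lambda>k. u (r1 (r2 k)) x)"
    by (rule convergent_subsequence[of "\<lambda>k. u (r1 k)", OF u E])
  define r where "r = r1 \<circ> r2"
  have r: "strict_mono r" unfolding r_def by (intro strict_mono_o r1 r2)
  \<comment> \<open>A total limit operator keeps \<open>g\<close> Borel measurable; its values off
    the set of convergence are irrelevant.\<close>
  define g where "g x = lim (\<lambda>k. u (r k) x)" for x
  have um [measurable]: "u k \<in> borel_measurable borel" for k by (rule borel_DspD[OF u])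
  have gm [measurable]: "g \<in> borel_measurable borel"
    unfolding g_def[abs_def] by (rule borel_measurable_lim_metric) measurable
  have conv: "AE x in lborel. (\<lambda>k. u (r k) x) \<longlonglongrightarrow> g x"
    using r2(2) by eventually_elim (simp add: g_def r_def convergent_LIMSEQ_iff)
  have "integrable lborel (\<lambda>x. \<bar>g x\<bar> powr q)"
    by (rule fatou_powr[of "\<lambda>k. u (r k)" lborel g q C'])
      (use conv q_gt_1 u M in \<open>auto intro: borel_Dsp_mass simp: mass_def\<close>)
  moreover have conv2: "AE z in lborel. (\<lambda>k. diff_quot (u (r k)) z) \<longlonglongrightarrow> diff_quot g z"
    by (rule AE_diff_quot_tendsto[OF conv])
  have "integrable lborel (\<lambda>z. \<bar>diff_quot g z\<bar> powr p)"
    by (rule fatou_powr[of "\<lambda>k. diff_quot (u (r k))" lborel "diff_quot g" p C])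
      (use conv2 p_gt_1 u E in \<open>auto intro: borel_Dsp_diff_quot simp: energy_eq[symmetric]\<close>)
  ultimately have g: "g \<in> borel_Dsp" by (simp add: borel_Dsp_def)
  have lim_w: "(\<lambda>k. LINT x|W. \<bar>u (r k) x - w x\<bar> powr p) \<longlonglongrightarrow> 0"
    using LIMSEQ_subseq_LIMSEQ[OF r1(4) r2(1)] by (simp add: comp_def r_def)
  have gw: "AE x in W. g x = w x"
    using r1(5) AE_W[OF conv]
  proof eventually_elim
    case (elim x)
    then have "(\<lambda>k. u (r k) x) \<longlonglongrightarrow> w x"
      using LIMSEQ_subseq_LIMSEQ[OF elim(1) r2(1)] by (simp add: comp_def r_def)
    then show ?case using elim(2) LIMSEQ_unique by blast
  qed
  note mW = measurable_W[OF um] measurable_W[OF gm]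
  have id: "integrable W (\<lambda>x. \<bar>u k x - g x\<bar> powr p)" for k
    using p_gt_1 by (intro integrable_powr_diff mW integrable_potential u g) auto
  have "(LINT x|W. \<bar>u (r k) x - g x\<bar> powr p) = (LINT x|W. \<bar>u (r k) x - w x\<bar> powr p)" for k
  proof (rule integral_cong_AE)
    show "(\<lambda>x. \<bar>u (r k) x - g x\<bar> powr p) \<in> borel_measurable W" using mW by measurable
    show "(\<lambda>x. \<bar>u (r k) x - w x\<bar> powr p) \<in> borel_measurable W" using mW r1(2) by measurable
    show "AE x in W. \<bar>u (r k) x - g x\<bar> powr p = \<bar>u (r k) x - w x\<bar> powr p"
      using gw by eventually_elim simp
  qed
  with lim_w have lim_g: "(\<lambda>k. LINT x|W. \<bar>u (r k) x - g x\<bar> powr p) \<longlonglongrightarrow> 0" by simp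
  then obtain B where B: "\<And>k. (LINT x|W. \<bar>u (r k) x - g x\<bar> powr p) \<le> B"
    using convergent_imp_Bseq[OF convergentI[OF lim_g]] 
    unfolding Bseq_def real_norm_def by (meson abs_le_D1)
  have bd: "(LINT x|W. \<bar>u (r k) x\<bar> powr p) \<le> 2 powr p * (B + potential g)" for k
  proof -
    have "(LINT x|W. \<bar>u (r k) x\<bar> powr p)
        \<le> (LINT x|W. 2 powr p * (\<bar>u (r k) x - g x\<bar> powr p + \<bar>g x\<bar> powr p))"
    proof (rule integral_mono)
      show "integrable W (\<lambda>x. \<bar>u (r k) x\<bar> powr p)" by (rule integrable_potential[OF u])
      show "integrable W (\<lambda>x. 2 powr p * (\<bar>u (r k) x - g x\<bar> powr p + \<bar>g x\<bar> powr p))"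
        using id integrable_potential[OF g] by simp
      show "\<bar>u (r k) x\<bar> powr p \<le> 2 powr p * (\<bar>u (r k) x - g x\<bar> powr p + \<bar>g x\<bar> powr p)" for x
        using p_gt_1 abs_add_powr_le[of p "u (r k) x - g x" "g x"] by simp
    qed
    also have "\<dots> = 2 powr p * ((LINT x|W. \<bar>u (r k) x - g x\<bar> powr p) + potential g)"
      using id integrable_potential[OF g] by (simp add: potential_def)
    also have "\<dots> \<le> 2 powr p * (B + potential g)" using B by (intro mult_left_mono add_right_mono) auto
    finally show ?thesis .
  qed
  \<comment> \<open>Brezis--Lieb with a remainder that tends to 0, which yields convergence of the
    potentials themselves.\<close>
  have "(\<lambda>k. (LINT x|W. \<bar>u (r k) x\<bar> powr p) - (LINT x|W. \<bar>u (r k) x - g x\<bar> powr p))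
    \<longlonglongrightarrow> (LINT x|W. \<bar>g x\<bar> powr p)"
    using p_gt_1 by (intro brezis_lieb[OF _ _ AE_W[OF conv] _ _ bd] mW integrable_potential u) auto
  from tendsto_add[OF this lim_g] have "(\<lambda>k. potential (u (r k))) \<longlonglongrightarrow> potential g"
    by (simp add: potential_def)
  then show ?thesis by (rule that[OF r g conv])
qed

end

section \<open>Constrained minimisation\<close>

locale subcritical_eigenvalue = weighted_fractional_sobolev s p n q dims h x\<^sub>0
  for s p n q :: real and dims :: "'n::finite itself" and h :: "real ^ 'n \<Rightarrow> real"
    and x\<^sub>0 :: "real ^ 'n" +
  fixes lam :: real
  assumes lam_pos: "0 < lam" and lam_less: "lam < first_eigenvalue s p h"
begin

abbreviation lam1 :: real where "lam1 \<equiv> first_eigenvalue s p h"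

lemma eigenvalue_bound:
  assumes u: "u \<in> borel_Dsp"
  shows "lam1 * potential u \<le> energy u"
proof (cases "potential u > 0")
  case True
  have "lam1 \<le> energy u / potential u"
    unfolding first_eigenvalue_def
  proof (rule cInf_lower)
    show "energy u / potential u \<in> {energy v / (LINT x|lebesgue. h x * \<bar>v x\<bar> powr p) | v.
        v \<in> Dsp s p \<and> (LINT x|lebesgue. h x * \<bar>v x\<bar> powr p) > 0}"
      using u borel_Dsp_subset True by (auto simp: potential_eq[OF borel_DspD[OF u]])
    show "bdd_below {energy v / (LINT x|lebesgue. h x * \<bar>v x\<bar> powr p) | v.
        v \<in> Dsp s p \<and> (LINT x|lebesgue. h x * \<bar>v x\<bar> powr p) > 0}"
      by (rule bdd_belowI[of _ 0]) (auto intro!: divide_nonneg_pos energy_nonneg)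
  qed
  then show ?thesis using True by (simp add: pos_le_divide_eq)
next
  case False
  then have "potential u = 0" using potential_nonneg[of u] by simp
  then show ?thesis using energy_nonneg[of u] by simp
qed

definition Q :: "(real ^ 'n \<Rightarrow> real) \<Rightarrow> real" where
  "Q u = energy u - lam * potential u"

text \<open>The coercivity constant of \<open>Q\<close> relative to the energy. It bounds the energy
  along minimising sequences and makes \<open>S1\<close> positive.\<close>

definition gap :: real where "gap = 1 - lam / lam1"

lemma gap_pos: "0 < gap"
  using lam_pos lam_less by (simp add: gap_def)

lemma Q_coercive:
  assumes "u \<in> borel_Dsp"
  shows "gap * energy u \<le> Q u"
proof -
  have l1: "0 < lam1" using lam_pos lam_less by simp
  have "potential u \<le> energy u / lam1"
    using eigenvalue_bound[OF assms] l1 by (simp add: pos_le_divide_eq mult.commute)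
  then have "lam * potential u \<le> lam * (energy u / lam1)" using lam_pos by (intro mult_left_mono) auto
  then show ?thesis by (simp add: Q_def gap_def left_diff_distrib)
qed

lemma Q_nonneg: "u \<in> borel_Dsp \<Longrightarrow> 0 \<le> Q u"
  using Q_coercive[of u] gap_pos energy_nonneg[of u] mult_nonneg_nonneg[of gap "energy u"] by linarith

definition S0 :: real where "S0 = Inf (energy ` {u \<in> borel_Dsp. mass u = 1})"

definition S1 :: real where "S1 = Inf (Q ` {u \<in> borel_Dsp. mass u = 1})"

lemma normalized_nonempty: "{u \<in> borel_Dsp. mass u = 1} \<noteq> {}"
  using ex_mass_eq_1[OF s_less_1] by blast

lemma S0_lower: "u \<in> borel_Dsp \<Longrightarrow> mass u = 1 \<Longrightarrow> S0 \<le> energy u"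
  unfolding S0_def by (rule cInf_lower) (auto intro!: bdd_belowI[of _ 0] energy_nonneg)

lemma S1_lower: "u \<in> borel_Dsp \<Longrightarrow> mass u = 1 \<Longrightarrow> S1 \<le> Q u"
  unfolding S1_def by (rule cInf_lower) (auto intro!: bdd_belowI[of _ 0] Q_nonneg)

lemma S0_approx:
  assumes "0 < e" obtains u where "u \<in> borel_Dsp" "mass u = 1" "energy u < S0 + e"
  using cInf_lessD[of "energy ` {u \<in> borel_Dsp. mass u = 1}" "S0 + e"] normalized_nonempty assms
  unfolding S0_def by auto

lemma S1_approx:
  assumes "0 < e" obtains u where "u \<in> borel_Dsp" "mass u = 1" "Q u < S1 + e"
  using cInf_lessD[of "Q ` {u \<in> borel_Dsp. mass u = 1}" "S1 + e"] normalized_nonempty assms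
  unfolding S1_def by auto

lemma S0_pos: "0 < S0"
proof -
  define A where "A = sobolev_const * (2 * omega powr (- 1 / q)) powr (q - p)"
  have A: "0 < A" using sobolev_const_pos omega_pos by (simp add: A_def)
  have "1 / A \<le> S0"
    unfolding S0_def
  proof (rule cInf_greatest)
    fix y assume "y \<in> energy ` {u \<in> borel_Dsp. mass u = 1}"
    then obtain u where u: "u \<in> borel_Dsp" "mass u = 1" "y = energy u" by blast
    show "1 / A \<le> y"
      using sobolev_normalized[OF u(1,2), folded A_def] A u(3) by (simp add: pos_divide_le_eq mult.commute)
  qed (use normalized_nonempty in simp)
  then show ?thesis using A by (meson divide_pos_pos less_le_trans zero_less_one)
qed

lemma S1_pos: "0 < S1"
proof -
  have "gap * S0 \<le> S1"
    unfolding S1_def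
  proof (rule cInf_greatest)
    fix y assume "y \<in> Q ` {u \<in> borel_Dsp. mass u = 1}"
    then obtain u where u: "u \<in> borel_Dsp" "mass u = 1" "y = Q u" by blast
    have "gap * S0 \<le> gap * energy u" using S0_lower[OF u(1,2)] gap_pos by simp
    then show "gap * S0 \<le> y" using Q_coercive[OF u(1)] u(3) by simp
  qed (use normalized_nonempty in simp)
  then show ?thesis using mult_pos_pos[OF gap_pos S0_pos] by linarith
qed

lemma Q_scale:
  assumes "u \<in> borel_measurable borel"
  shows "Q (\<lambda>x. c * u x) = \<bar>c\<bar> powr p * Q u"
  by (simp add: Q_def energy_scale[OF assms] potential_scale algebra_simps)

lemma normalize:
  assumes u: "u \<in> borel_Dsp" and m: "0 < mass u"
  defines "c \<equiv> mass u powr (- 1 / q)"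
  shows "(\<lambda>x. c * u x) \<in> borel_Dsp" "mass (\<lambda>x. c * u x) = 1" "\<bar>c\<bar> powr p * mass u powr (p / q) = 1"
proof -
  show "(\<lambda>x. c * u x) \<in> borel_Dsp" by (rule borel_Dsp_scale[OF u])
  show "mass (\<lambda>x. c * u x) = 1"
    unfolding mass_scale c_def using m q_gt_1 by (simp add: powr_powr powr_neg_one)
  show "\<bar>c\<bar> powr p * mass u powr (p / q) = 1"
    unfolding c_def using m by (simp add: powr_powr flip: powr_add)
qed

text \<open>Homogeneous form of the definition of \<open>S0\<close>: energy has degree
  \<open>p\<close>, mass degree \<open>q\<close>, hence the exponent \<open>p / q\<close>.\<close>

lemma energy_ge:
  assumes u: "u \<in> borel_Dsp"
  shows "S0 * mass u powr (p / q) \<le> energy u"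
proof (cases "mass u = 0")
  case True
  then show ?thesis using energy_nonneg by simp
next
  case False
  then have m: "0 < mass u" using mass_nonneg[of u] by simp
  note N = normalize[OF u m]
  let ?c = "mass u powr (- 1 / q)"
  have "S0 * mass u powr (p / q) \<le> (\<bar>?c\<bar> powr p * energy u) * mass u powr (p / q)"
    using S0_lower[OF N(1,2)] by (intro mult_right_mono) (simp_all add: energy_scale[OF borel_DspD[OF u]])
  also have "\<dots> = (\<bar>?c\<bar> powr p * mass u powr (p / q)) * energy u" by (simp only: mult_ac)
  finally show ?thesis unfolding N(3) by simp
qed

lemma Q_ge:
  assumes u: "u \<in> borel_Dsp"
  shows "S1 * mass u powr (p / q) \<le> Q u"
proof (cases "mass u = 0")
  case True
  then show ?thesis using Q_nonneg[OF u] by simp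
next
  case False
  then have m: "0 < mass u" using mass_nonneg[of u] by simp
  note N = normalize[OF u m]
  let ?c = "mass u powr (- 1 / q)"
  have "S1 * mass u powr (p / q) \<le> (\<bar>?c\<bar> powr p * Q u) * mass u powr (p / q)"
    using S1_lower[OF N(1,2)] by (intro mult_right_mono) (simp_all add: Q_scale[OF borel_DspD[OF u]])
  also have "\<dots> = (\<bar>?c\<bar> powr p * mass u powr (p / q)) * Q u" by (simp only: mult_ac)
  finally show ?thesis unfolding N(3) by simp
qed

text \<open>Besides the lower bound, this yields integrability of
  \<open>\<bar>v x\<bar> powr p\<close> on the ball, which \<open>set_integral_abs_le\<close> needs
  to pass from the potential to the mean of \<open>\<bar>v\<bar>\<close>.\<close>

lemma potential_ge_ball:
  assumes v: "v \<in> borel_Dsp" and c: "0 < c" "\<And>x. x \<in> ball x\<^sub>0 rho \<Longrightarrow> c \<le> h x"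
  shows "integrable lborel (\<lambda>x. indicator (ball x\<^sub>0 rho) x * \<bar>v x\<bar> powr p)"
    and "c * (LINT x|lborel. indicator (ball x\<^sub>0 rho) x * \<bar>v x\<bar> powr p) \<le> potential v"
proof -
  note [measurable] = borel_DspD[OF v]
  have [measurable]: "ball x\<^sub>0 rho \<in> sets borel" by simp
  let ?f = "\<lambda>x. indicator (ball x\<^sub>0 rho) x * \<bar>v x\<bar> powr p"
  have f [measurable]: "?f \<in> borel_measurable borel" by measurable
  have fl: "?f \<in> borel_measurable lborel" by measurable
  have vl: "(\<lambda>x. \<bar>v x\<bar> powr p) \<in> borel_measurable lebesgue"
    by (rule measurable_completion) measurable
  have le: "AE x in lebesgue. c * ?f x \<le> h x * \<bar>v x\<bar> powr p"
    using h_nonneg by eventually_elim (auto simp: indicator_def intro!: mult_right_mono c(2))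
  have int: "integrable lebesgue (\<lambda>x. h x * \<bar>v x\<bar> powr p)"
    using integrable_potential[OF v] vl by (simp add: integrable_W)
  have icf: "integrable lebesgue (\<lambda>x. c * ?f x)"
  proof (rule Bochner_Integration.integrable_bound[OF int])
    show "AE x in lebesgue. norm (c * ?f x) \<le> norm (h x * \<bar>v x\<bar> powr p)"
      using le
    proof eventually_elim
      case (elim x)
      have "0 \<le> c * ?f x" using c(1) by simp
      then show ?case using elim unfolding real_norm_def by linarith
    qed
    show "(\<lambda>x. c * ?f x) \<in> borel_measurable lebesgue"
      by (rule measurable_completion) measurable
  qed
  then have "integrable lebesgue ?f" using c(1) by simp
  then show "integrable lborel ?f" by (simp add: integrable_completion[OF fl])
  have "c * (LINT x|lborel. ?f x) = (LINT x|lebesgue. c * ?f x)"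
    using integral_completion[OF fl] by simp
  also have "\<dots> \<le> potential v"
    unfolding potential_eq[OF borel_DspD[OF v]] by (rule integral_mono_AE[OF icf int le])
  finally show "c * (LINT x|lborel. ?f x) \<le> potential v" .
qed

text \<open>No extremal function for \<open>S0\<close> is needed: a near-minimiser rescaled so as not to vanish
  where \<open>h\<close> is positive gains a fixed amount from the potential.\<close>

lemma S1_less_S0: "S1 < S0"
proof -
  obtain rho c where rho: "0 < rho" "0 < c" and hc: "\<And>x. x \<in> ball x\<^sub>0 rho \<Longrightarrow> c \<le> h x"
    using h_lower_bound by blast
  have "0 < S0 + 1" using S0_pos by simp
  then obtain M where M: "0 < M" and conc: "\<And>u. u \<in> borel_Dsp \<Longrightarrow> mass u = 1 \<Longrightarrow> energy u \<le> S0 + 1 \<Longrightarrow>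
      \<exists>v\<in>borel_Dsp. mass v = 1 \<and> energy v = energy u \<and>
        M \<le> (LINT y|lborel. indicator (ball x\<^sub>0 rho) y * \<bar>v y\<bar>)"
    by (rule concentration[OF _ rho(1), of _ x\<^sub>0]) blast
  let ?B = "ball x\<^sub>0 rho"
  note B = ball_facts[OF rho(1), of x\<^sub>0]
  \<comment> \<open>Chosen so that \<open>2 * K * measure lborel ?B = M / 2\<close>: a potential
    below \<open>d\<close> would make the integral of \<open>\<bar>v\<bar>\<close> over the ball at
    most half of the guaranteed \<open>M\<close>.\<close>
  define K where "K = M / (4 * measure lborel ?B)"
  have K: "0 < K" unfolding K_def using M B(2) by (intro divide_pos_pos mult_pos_pos) auto
  define d where "d = c * (measure lborel ?B * K powr p)"
  have d: "0 < d" unfolding d_def using rho(2) B(2) K by (intro mult_pos_pos) auto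
  \<comment> \<open>\<open>min 1\<close> keeps \<open>u\<close> below the energy level for which
    \<open>M\<close> was fixed; \<open>lam * d\<close> is the guaranteed gain, and it does not
    depend on \<open>u\<close>.\<close>
  obtain u where u: "u \<in> borel_Dsp" "mass u = 1" "energy u < S0 + min 1 (lam * d)"
    using S0_approx[of "min 1 (lam * d)"] d lam_pos by auto
  obtain v where v: "v \<in> borel_Dsp" "mass v = 1" "energy v = energy u"
      "M \<le> (LINT y|lborel. indicator ?B y * \<bar>v y\<bar>)"
    using conc[OF u(1,2)] u(3) by fastforce
  note [measurable] = borel_DspD[OF v(1)]
  have "d \<le> potential v"
  proof (rule ccontr)
    assume "\<not> d \<le> potential v"
    then have "c * (LINT x|lborel. indicator ?B x * \<bar>v x\<bar> powr p) < c * (measure lborel ?B * K powr p)"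
      using potential_ge_ball(2)[of v c rho, OF v(1) rho(2) hc] unfolding d_def by linarith
    then have "(LINT x|lborel. indicator ?B x * \<bar>v x\<bar> powr p) \<le> measure lborel ?B * K powr p"
      using rho(2) by simp
    then have "(LINT y|lborel. indicator ?B y * \<bar>v y\<bar>) \<le> 2 * K * measure lborel ?B"
      by (intro set_integral_abs_le(2)[OF _ _ B p_gt_1 potential_ge_ball(1)[of v c rho, OF v(1) rho(2) hc] _ K]) simp_all
    also have "\<dots> = M / 2" using B(2) by (simp add: K_def)
    finally show False using v(4) M by simp
  qed
  then have "lam * d \<le> lam * potential v" using lam_pos by simp
  then have "Q v < S0" using u(3) v(3) by (simp add: Q_def)
  then show ?thesis using S1_lower[OF v(1,2)] by simp
qed

text \<open>Mass and energy split between the limit and the remainder, but the potential converges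
  without loss. The remainder is therefore charged through \<open>energy_ge\<close> with
  \<open>S0\<close>, the limit through \<open>Q_ge\<close> with \<open>S1\<close>.\<close>

lemma ex_minimizer:
  obtains g where "g \<in> borel_Dsp" "mass g = 1" "Q g = S1"
proof -
  have "\<exists>u. u \<in> borel_Dsp \<and> mass u = 1 \<and> Q u < S1 + 1 / real (Suc k)" for k
    using S1_approx[of "1 / real (Suc k)"] by (metis divide_pos_pos of_nat_0_less_iff zero_less_Suc zero_less_one)
  then obtain u where u: "\<And>k. u k \<in> borel_Dsp" "\<And>k. mass (u k) = 1" "\<And>k. Q (u k) < S1 + 1 / real (Suc k)"
    by metis
  have E: "energy (u k) \<le> (S1 + 1) / gap" for k
  proof -
    have "1 / real (Suc k) \<le> 1" by simp
    then have "gap * energy (u k) \<le> S1 + 1" using u(3)[of k] Q_coercive[OF u(1)[of k]] by linarith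
    then show ?thesis using gap_pos by (simp add: pos_le_divide_eq mult.commute)
  qed
  have M: "mass (u k) \<le> 1" for k using u(2) by simp
  obtain r g where r: "strict_mono r" and g: "g \<in> borel_Dsp"
    and conv: "AE x in lborel. (\<lambda>k. u (r k) x) \<longlonglongrightarrow> g x"
    and pot: "(\<lambda>k. potential (u (r k))) \<longlonglongrightarrow> potential g"
    by (rule compactness[of u, OF u(1) E M])
  have um [measurable]: "u k \<in> borel_measurable borel" for k by (rule borel_DspD[OF u(1)])
  note [measurable] = borel_DspD[OF g]
  have dg: "(\<lambda>x. u k x - g x) \<in> borel_Dsp" for k by (rule borel_Dsp_diff[OF u(1) g])
  have conv2: "AE z in lborel. (\<lambda>k. diff_quot (u (r k)) z) \<longlonglongrightarrow> diff_quot g z"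
    by (rule AE_diff_quot_tendsto[OF conv])
  have "(\<lambda>k. (LINT x|lborel. \<bar>u (r k) x\<bar> powr q) - (LINT x|lborel. \<bar>u (r k) x - g x\<bar> powr q))
      \<longlonglongrightarrow> (LINT x|lborel. \<bar>g x\<bar> powr q)"
    by (rule brezis_lieb[of "\<lambda>k. u (r k)" lborel g q 1])
      (use conv q_gt_1 u(1) M in \<open>auto intro: borel_Dsp_mass simp: mass_def\<close>)
  then have blm: "(\<lambda>k. 1 - mass (\<lambda>x. u (r k) x - g x)) \<longlonglongrightarrow> mass g"
    using u(2) by (simp add: mass_def)
  have "(\<lambda>k. (LINT z|lborel. \<bar>diff_quot (u (r k)) z\<bar> powr p)
        - (LINT z|lborel. \<bar>diff_quot (u (r k)) z - diff_quot g z\<bar> powr p))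
      \<longlonglongrightarrow> (LINT z|lborel. \<bar>diff_quot g z\<bar> powr p)"
    by (rule brezis_lieb[of "\<lambda>k. diff_quot (u (r k))" lborel "diff_quot g" p "(S1 + 1) / gap"])
      (use conv2 p_gt_1 u(1) E in \<open>auto intro: borel_Dsp_diff_quot simp: energy_eq[symmetric]\<close>)
  then have ble: "(\<lambda>k. energy (u (r k)) - energy (\<lambda>x. u (r k) x - g x)) \<longlonglongrightarrow> energy g"
    by (simp add: energy_eq diff_quot_diff)
  define b where "b k = mass (\<lambda>x. u (r k) x - g x)" for k
  define a where "a = mass g"
  have b: "b \<longlonglongrightarrow> 1 - a"
    using tendsto_diff[OF tendsto_const[of 1] blm] by (simp add: b_def[abs_def] a_def)
  have b0: "0 \<le> b k" for k by (simp add: b_def mass_nonneg)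
  have a: "0 \<le> a" "a \<le> 1"
    using LIMSEQ_le_const[OF b, of 0] b0 by (auto simp: a_def mass_nonneg)
  define th where "th = p / q"
  have th: "0 < th" "th < 1" using p_gt_1 q_gt_p by (auto simp: th_def)
  have limQ: "(\<lambda>k. S1 + 1 / real (Suc (r k))) \<longlonglongrightarrow> S1"
  proof -
    have "(\<lambda>k. 1 / real (Suc (r k))) \<longlonglongrightarrow> 0"
      using LIMSEQ_subseq_LIMSEQ[OF LIMSEQ_Suc[OF lim_1_over_n] r] by (simp add: comp_def)
    from tendsto_add[OF tendsto_const this, of S1] show ?thesis by simp
  qed
  \<comment> \<open>The energy of the remainder need not converge, so it is replaced by the lower
    bound \<open>S0 * b k powr th\<close>, whose limit is known.\<close>
  have "(\<lambda>k. (energy (u (r k)) - energy (\<lambda>x. u (r k) x - g x)) + S0 * b k powr th - lam * potential (u (r k)))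
      \<longlonglongrightarrow> energy g + S0 * (1 - a) powr th - lam * potential g"
    using th b0 by (intro tendsto_intros ble pot tendsto_powr2 b) auto
  then have "energy g + S0 * (1 - a) powr th - lam * potential g \<le> S1"
  proof (rule LIMSEQ_le[OF _ limQ], intro exI[of _ 0] allI impI)
    fix k
    have "S0 * b k powr th \<le> energy (\<lambda>x. u (r k) x - g x)"
      unfolding b_def th_def by (rule energy_ge[OF dg])
    then show "(energy (u (r k)) - energy (\<lambda>x. u (r k) x - g x)) + S0 * b k powr th - lam * potential (u (r k))
        \<le> S1 + 1 / real (Suc (r k))"
      using u(3)[of "r k"] unfolding Q_def by linarith
  qed
  then have *: "Q g + S0 * (1 - a) powr th \<le> S1" by (simp add: Q_def)
  \<comment> \<open>On the unit interval \<open>t \<le> t powr th\<close>. If \<open>a < 1\<close>,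
    the two pieces cost at least \<open>S1 * a + S0 * (1 - a)\<close>, which exceeds
    \<open>S1\<close>; the case \<open>a = 0\<close> of total loss is included.\<close>
  have "a = 1"
  proof (rule ccontr)
    assume "a \<noteq> 1"
    then have a1: "0 < 1 - a" using a by simp
    have "S1 * a \<le> S1 * a powr th"
      using powr_mono'[of th 1 a] a th S1_pos by simp
    moreover have "S1 * a powr th \<le> Q g" using Q_ge[OF g] by (simp add: a_def th_def)
    moreover have "S1 * (1 - a) < S0 * (1 - a)" using S1_less_S0 a1 by simp
    moreover have "S0 * (1 - a) \<le> S0 * (1 - a) powr th"
      using powr_mono'[of th 1 "1 - a"] a a1 th S0_pos by simp
    ultimately have "S1 * a + S1 * (1 - a) < S1" using * by linarith
    then show False by (simp add: algebra_simps)
  qed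
  then have "mass g = 1" "Q g \<le> S1" using * by (simp_all add: a_def)
  then show ?thesis using that[of g] S1_lower[OF g] g by force
qed

section \<open>First variation and the weak equation\<close>

lemma DERIV_mass:
  assumes u: "u \<in> borel_Dsp" and v: "v \<in> borel_Dsp"
  shows "((\<lambda>t. mass (\<lambda>x. u x + t * v x)) has_real_derivative
    q * (LINT x|lborel. \<bar>u x\<bar> powr (q - 2) * u x * v x)) (at 0)"
  unfolding mass_def
  using borel_DspD[OF u] borel_DspD[OF v]
  by (intro has_real_derivative_integral_abs_powr borel_Dsp_mass u v q_gt_1) auto

lemma DERIV_potential:
  assumes u: "u \<in> borel_Dsp" and v: "v \<in> borel_Dsp"
  shows "((\<lambda>t. potential (\<lambda>x. u x + t * v x)) has_real_derivative
    p * (LINT x|W. \<bar>u x\<bar> powr (p - 2) * u x * v x)) (at 0)"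
  unfolding potential_def
  by (intro has_real_derivative_integral_abs_powr integrable_potential u v p_gt_1 measurable_W borel_DspD)

lemma DERIV_energy:
  assumes u: "u \<in> borel_Dsp" and v: "v \<in> borel_Dsp"
  shows "((\<lambda>t. energy (\<lambda>x. u x + t * v x)) has_real_derivative
    p * (LINT z|lborel. \<bar>diff_quot u z\<bar> powr (p - 2) * diff_quot u z * diff_quot v z)) (at 0)"
proof -
  note [measurable] = borel_DspD[OF u] borel_DspD[OF v]
  have "energy (\<lambda>x. u x + t * v x) = (LINT z|lborel. \<bar>diff_quot u z + t * diff_quot v z\<bar> powr p)" for t
    by (subst energy_eq) (simp_all add: diff_quot_add diff_quot_scale)
  moreover have "((\<lambda>t. LINT z|lborel. \<bar>diff_quot u z + t * diff_quot v z\<bar> powr p) has_real_derivative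
      p * (LINT z|lborel. \<bar>diff_quot u z\<bar> powr (p - 2) * diff_quot u z * diff_quot v z)) (at 0)"
    by (intro has_real_derivative_integral_abs_powr borel_Dsp_diff_quot u v p_gt_1) simp_all
  ultimately show ?thesis by simp
qed

text \<open>By \<open>Q_ge\<close> the function \<open>phi\<close> is nonnegative along every line,
  and it vanishes at \<open>w\<close>. The constrained problem thus becomes an unconstrained minimum
  in \<open>t\<close>, and no multiplier argument arises. The hypothesis \<open>norm\<close> makes
  the coefficient of the critical term equal to 1.\<close>

lemma euler_lagrange:
  assumes w: "w \<in> borel_Dsp" and min: "Q w = S1 * mass w powr (p / q)" and m: "0 < mass w"
    and norm: "S1 * mass w powr (p / q - 1) = 1" and v: "v \<in> borel_Dsp"
  shows "(LINT z|lborel. \<bar>diff_quot w z\<bar> powr (p - 2) * diff_quot w z * diff_quot v z)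
    = lam * (LINT x|W. \<bar>w x\<bar> powr (p - 2) * w x * v x)
      + (LINT x|lborel. \<bar>w x\<bar> powr (q - 2) * w x * v x)" (is "?A = lam * ?B + ?C")
proof -
  let ?w = "\<lambda>t x. w x + t * v x"
  define phi where "phi t = energy (?w t) - lam * potential (?w t) - S1 * mass (?w t) powr (p / q)" for t
  have m0: "mass (?w 0) > 0" using m by simp
  have D_mass: "((\<lambda>t. mass (?w t) powr (p / q)) has_real_derivative
      p / q * mass (?w 0) powr (p / q - 1) * (q * ?C)) (at 0)"
    by (rule DERIV_chain2[OF has_real_derivative_powr[OF m0] DERIV_mass[OF w v]])
  have "(phi has_real_derivative p * ?A - lam * (p * ?B)
      - S1 * (p / q * mass (?w 0) powr (p / q - 1) * (q * ?C))) (at 0)"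
    unfolding phi_def[abs_def]
    by (intro DERIV_diff DERIV_cmult DERIV_energy[OF w v] DERIV_potential[OF w v] D_mass)
  also have "p * ?A - lam * (p * ?B) - S1 * (p / q * mass (?w 0) powr (p / q - 1) * (q * ?C))
      = p * (?A - lam * ?B - (S1 * mass w powr (p / q - 1)) * ?C)"
    using q_gt_1 by (simp add: algebra_simps)
  finally have D: "(phi has_real_derivative p * (?A - lam * ?B - ?C)) (at 0)"
    unfolding norm by simp
  have "phi 0 \<le> phi t" for t
  proof -
    have "phi 0 = 0" using min by (simp add: phi_def Q_def)
    moreover have "0 \<le> phi t"
      using Q_ge[OF borel_Dsp_add[OF w borel_Dsp_scale[OF v, of t]]] by (simp add: phi_def Q_def)
    ultimately show ?thesis by simp
  qed
  then have "p * (?A - lam * ?B - ?C) = 0"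
    using DERIV_local_min[OF D, of 1] by simp
  then show ?thesis using p_gt_1 by simp
qed

text \<open>The denominators contribute the powers \<open>p - 2\<close>, 1 and 1, which combine to
  \<open>p\<close>; on the diagonal both sides are 0.\<close>

lemma diff_quot_weak_form:
  "\<bar>diff_quot u (x, y)\<bar> powr (p - 2) * diff_quot u (x, y) * diff_quot v (x, y)
    = \<bar>u x - u y\<bar> powr (p - 2) * (u x - u y) * (v x - v y) / norm (x - y) powr (n + s * p)"
proof (cases "x = y")
  case False
  define a where "a = norm (x - y) powr (n / p + s)"
  have a: "0 < a" using False by (simp add: a_def)
  have "(n / p + s) * p = n + s * p" using p_gt_1 by (simp add: algebra_simps)
  then have ap: "norm (x - y) powr (n + s * p) = a powr p" by (simp add: a_def powr_powr)
  have "a powr p = a powr (p - 2) * a powr 2" by (simp flip: powr_add)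
  also have "\<dots> = a powr (p - 2) * (a * a)" using a by (simp add: powr_numeral power2_eq_square)
  finally have a2: "a powr p = a powr (p - 2) * (a * a)" .
  show ?thesis
    unfolding ap a2 diff_quot_def fst_conv snd_conv a_def[symmetric]
    using a by (simp add: abs_divide powr_divide)
qed (simp add: diff_quot_def)

lemma ex_weak_solution:
  "\<exists>u. weak_solution s p lam h u \<and> \<not> (AE x in lebesgue. u x = 0)"
proof -
  obtain g where g: "g \<in> borel_Dsp" "mass g = 1" "Q g = S1" by (rule ex_minimizer)
  \<comment> \<open>With \<open>mass w = c powr q\<close>, the normalisation required by
    \<open>euler_lagrange\<close> reads \<open>S1 * c powr (p - q) = 1\<close>; this is its
    solution.\<close>
  define c where "c = S1 powr (1 / (q - p))"
  have c: "0 < c" using S1_pos by (simp add: c_def)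
  define w where "w = (\<lambda>x. c * g x)"
  have w: "w \<in> borel_Dsp" unfolding w_def by (rule borel_Dsp_scale[OF g(1)])
  have mw: "mass w = c powr q" unfolding w_def mass_scale using c g(2) by simp
  have m: "0 < mass w" unfolding mw using c by simp
  \<comment> \<open>Minimality survives the rescaling because both sides have degree
    \<open>p\<close> in \<open>c\<close>.\<close>
  have min: "Q w = S1 * mass w powr (p / q)"
    unfolding mw unfolding w_def Q_scale[OF borel_DspD[OF g(1)]] using c g(3) q_gt_1 by (simp add: powr_powr)
  have norm: "S1 * mass w powr (p / q - 1) = 1"
  proof -
    have "q * (p / q - 1) = p - q" using q_gt_1 by (simp add: right_diff_distrib)
    then have "mass w powr (p / q - 1) = c powr (p - q)" by (simp add: mw powr_powr)
    also have "\<dots> = S1 powr (1 / (q - p) * (p - q))" by (simp add: c_def powr_powr)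
    also have "1 / (q - p) * (p - q) = - 1" using q_gt_p by (simp add: field_simps)
    finally show ?thesis using S1_pos by (simp add: powr_neg_one)
  qed
  note [measurable] = borel_DspD[OF w]
  have "weak_solution s p lam h w"
    unfolding weak_solution_def
  proof (intro conjI ballI)
    show "w \<in> Dsp s p" using w borel_Dsp_subset by blast
    fix v :: "real ^ 'n \<Rightarrow> real" assume "v \<in> test_functions"
    then have v: "v \<in> borel_Dsp" by (rule test_functions_in_borel_Dsp[OF s_less_1])
    note [measurable] = borel_DspD[OF v]
    have "(LINT (x, y)|lebesgue. \<bar>w x - w y\<bar> powr (p - 2) * (w x - w y) * (v x - v y)
             / norm (x - y) powr (n + s * p))
        = (LINT z|lebesgue. \<bar>diff_quot w z\<bar> powr (p - 2) * diff_quot w z * diff_quot v z)"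
      by (intro Bochner_Integration.integral_cong) (auto simp: diff_quot_weak_form)
    also have "\<dots> = (LINT z|lborel. \<bar>diff_quot w z\<bar> powr (p - 2) * diff_quot w z * diff_quot v z)"
      by (rule integral_completion) measurable
    also have "\<dots> = lam * (LINT x|W. \<bar>w x\<bar> powr (p - 2) * w x * v x)
        + (LINT x|lborel. \<bar>w x\<bar> powr (q - 2) * w x * v x)"
      by (rule euler_lagrange[OF w min m norm v])
    also have "(LINT x|W. \<bar>w x\<bar> powr (p - 2) * w x * v x)
        = (LINT x|lebesgue. h x * (\<bar>w x\<bar> powr (p - 2) * w x * v x))"
      by (intro integral_W measurable_completion) measurable
    also have "(LINT x|lborel. \<bar>w x\<bar> powr (q - 2) * w x * v x)
        = (LINT x|lebesgue. \<bar>w x\<bar> powr (q - 2) * w x * v x)"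
      by (rule integral_completion[symmetric]) measurable
    finally show "(LINT (x, y)|lebesgue. \<bar>w x - w y\<bar> powr (p - 2) * (w x - w y) * (v x - v y)
             / norm (x - y) powr (real CARD('n) + s * p))
        = lam * (LINT x|lebesgue. h x * \<bar>w x\<bar> powr (p - 2) * w x * v x)
          + (LINT x|lebesgue. \<bar>w x\<bar> powr (critical_exponent CARD('n) s p - 2) * w x * v x)"
      by (simp add: n_eq q_def mult.assoc)
  qed
  moreover have "\<not> (AE x in lebesgue. w x = 0)"
  proof
    assume "AE x in lebesgue. w x = 0"
    then have "AE x in lborel. w x = 0" by (simp add: AE_completion_iff)
    then have "AE x in lborel. \<bar>w x\<bar> powr q = 0" by eventually_elim simp
    then have "mass w = 0" unfolding mass_def by (rule integral_eq_zero_AE)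
    then show False using m by simp
  qed
  ultimately show ?thesis by blast
qed

end

theorem theorem3p2:
  fixes s p lam :: real and h :: "real ^ 'n \<Rightarrow> real" and x\<^sub>0 :: "real ^ 'n"
  assumes "0 < s" and "s < 1" and "1 < p" and "s * p\<^sup>2 < real CARD('n)"
    and "h \<in> Linfty_space lebesgue" and "AE x in lebesgue. 0 \<le> h x"
    and "compactly_embedded (Dsp s p) (gagliardo_seminorm s p)
           (Lp_space (weighted_measure h) p) (Lp_norm (weighted_measure h) p)"
    and "isCont h x\<^sub>0" and "h x\<^sub>0 > 0"
    and "0 < lam" and "lam < first_eigenvalue s p h"
  shows "\<exists>u. weak_solution s p lam h u \<and> \<not> (AE x in lebesgue. u x = 0)"
proof -
  \<comment> \<open>From \<open>1 < p\<close> follows \<open>s * p \<le> s * p * p < n\<close>,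
    which makes the critical exponent finite and positive.\<close>
  have "s * p * 1 \<le> s * p * p" using assms(1,3) by (intro mult_left_mono) auto
  then have "s * p < real CARD('n)" using assms(4) by (simp add: power2_eq_square mult.assoc)
  moreover have "h \<in> borel_measurable lebesgue" using assms(5) by (simp add: Linfty_space_def)
  ultimately interpret subcritical_eigenvalue s p "real CARD('n)" "critical_exponent CARD('n) s p"
      "TYPE('n)" h x\<^sub>0 lam
    by unfold_locales (assumption | rule refl assms)+
  show ?thesis by (rule ex_weak_solution)
qed

end
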